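(* Let $k\in\mathbb{N}_+$, $\underline{\lambda}=(\lambda_1,\dots,\lambda_k)\in\mathbb{R}_+^k$ and let $G_n\sim\mathcal{G}_n([n],\underline{\lambda})$ for $n\in\mathbb{N}_+$. Assume that $k\ge 2$ and that $\sum_{i\in I}\lambda_i<1$ for every $I\subseteq[k]$ with $|I|\le k-2$. If $f^*_\infty>0$, then asymptotically almost surely as $n\to\infty$ (i.e. with probability tending to $1$) $G_n$ has a unique largest color-avoiding connected component.
   Context: Notation: $\mathbb{N}_+=\{1,2,\dots\}$, $\mathbb{R}_+=(0,\infty)$, $[n]=\{1,\dots,n\}$. Edge-colored graphs. An edge-colored (multi)graph with $k$ colors is $G=(V,\underline{E})$ with $\underline{E}=(E_1,\dots,E_k)$, $E_i\subseteq\binom{V}{2}$ (the set of edges of color $i$; the $E_i$ need not be disjoint and the coloring need not be proper). For $I\subseteq[k]$ let $G^I$ be the simple uncolored graph $(V,\bigcup_{i\in I}E_i)$, and $G^{\setminus i}=G^{[k]\setminus\{i\}}$. Vertices $v,w$ are $i$-avoiding connected (written $v\stackrel{G^{\setminus i}}{\longleftrightarrow}w$) if they are in the same component of $G^{\setminus i}$, and color-avoiding connected if they are $i$-avoiding connected for all $i\in[k]$. This is an equivalence relation; its classes are the color-avoiding connected components. ECER graphs. For a vertex set $V$ with $|V|\le n$, $G\sim\mathcal{G}_n(V,\underline{\lambda})$ means that $G=(V,(E_1,\dots,E_k))$ is random, $E_1,\dots,E_k$ are independent, and each element of $\binom{V}{2}$ is included in $E_i$ independently with probability $1-\exp(-\lambda_i/n)$.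 ECBP trees. $G_\infty=G_\infty(r)\sim\mathcal{G}_\infty(\underline{\lambda})$ denotes the random (possibly infinite) edge-colored tree with root $r$ generated recursively: given the tree up to generation $d$, each vertex $v$ in generation $d$ has $X_{v,i}\sim\mathrm{POI}(\lambda_i)$ children joined to it by an edge of color $i$ ($i\in[k]$), all these variables being conditionally independent. For a vertex $v$, write $v\stackrel{G_\infty^{\setminus i}}{\longleftrightarrow}\infty$ if there is an infinite path starting at $v$ without edges of color $i$ all of whose vertices are descendants of $v$. The root $r$ and $v$ are $i$-avoiding friends if either $r\stackrel{G_\infty^{\setminus i}}{\longleftrightarrow}v$, or both $r\stackrel{G_\infty^{\setminus i}}{\longleftrightarrow}\infty$ and $v\stackrel{G_\infty^{\setminus i}}{\longleftrightarrow}\infty$. They are friends if they are $i$-avoiding friends for all $i\in[k]$. $\widetilde{\mathcal{C}}^*(r)$ is the set of friends of $r$ (it contains $r$), and $f^*_\infty=\mathbb{P}(|\widetilde{\mathcal{C}}^*(r)|=\infty)$. *)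

theory Defs
  imports "HOL-Probability.Probability" "HOL-Library.Ramsey" "HOL-Library.Sublist"
begin

section \<open>Edge-colored graphs\<close>

text \<open>
  An edge-colored graph is a pair \<open>(V, E)\<close> where \<open>E i\<close> is the set of edges of color \<open>i\<close>, an edge
  being a two-element subset of \<open>V\<close>. The colors are \<open>1, \<dots>, k\<close>; the number \<open>k\<close> is always an
  explicit parameter and \<open>E i\<close> is irrelevant for other \<open>i\<close>.
\<close>

type_synonym 'v ecgraph = "'v set \<times> (nat \<Rightarrow> 'v set set)"

definition vertices :: "'v ecgraph \<Rightarrow> 'v set" where
  "vertices G = fst G"

text \<open>The edges of the simple uncolored graph \<open>G\<^sup>I\<close>.\<close>

definition edges_of_colors :: "'v ecgraph \<Rightarrow> nat set \<Rightarrow> 'v set set" where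
  "edges_of_colors G I = (\<Union>i\<in>I. snd G i)"

text \<open>Being in the same connected component of \<open>G\<^sup>I\<close>.\<close>

definition connected_by :: "'v ecgraph \<Rightarrow> nat set \<Rightarrow> 'v \<Rightarrow> 'v \<Rightarrow> bool" where
  "connected_by G I v w \<longleftrightarrow> v \<in> vertices G \<and> w \<in> vertices G \<and>
     (v, w) \<in> {(x, y). {x, y} \<in> edges_of_colors G I}\<^sup>*"

definition avoiding_connected :: "nat \<Rightarrow> 'v ecgraph \<Rightarrow> nat \<Rightarrow> 'v \<Rightarrow> 'v \<Rightarrow> bool" where
  "avoiding_connected k G i v w \<longleftrightarrow> connected_by G ({1..k} - {i}) v w"

definition color_avoiding_connected :: "nat \<Rightarrow> 'v ecgraph \<Rightarrow> 'v \<Rightarrow> 'v \<Rightarrow> bool" where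
  "color_avoiding_connected k G v w \<longleftrightarrow> (\<forall>i\<in>{1..k}. avoiding_connected k G i v w)"

definition color_avoiding_components :: "nat \<Rightarrow> 'v ecgraph \<Rightarrow> 'v set set" where
  "color_avoiding_components k G =
     vertices G // {(v, w) \<in> vertices G \<times> vertices G. color_avoiding_connected k G v w}"

definition is_largest_component :: "nat \<Rightarrow> 'v ecgraph \<Rightarrow> 'v set \<Rightarrow> bool" where
  "is_largest_component k G C \<longleftrightarrow> C \<in> color_avoiding_components k G \<and>
     (\<forall>D\<in>color_avoiding_components k G. card D \<le> card C)"


section \<open>Edge-colored Erdos-Renyi graphs\<close>

text \<open>
  The law of the random graph on a finite vertex set \<open>V\<close>: the indicators of \<open>e \<in> E i\<close>, for
  \<open>i \<in> {1..k}\<close> and \<open>e\<close> a two-element subset of \<open>V\<close>, are independent Bernoulli variables.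
\<close>

definition ecer :: "nat \<Rightarrow> 'v set \<Rightarrow> nat \<Rightarrow> (nat \<Rightarrow> real) \<Rightarrow> 'v ecgraph pmf" where
  "ecer n V k lam =
     map_pmf (\<lambda>\<omega>. (V, \<lambda>i. {e \<in> nsets V 2. \<omega> (i, e)}))
       (Pi_pmf ({1..k} \<times> nsets V 2) False
          (\<lambda>(i, e). bernoulli_pmf (1 - exp (- lam i / real n))))"


section \<open>Edge-colored branching process trees\<close>

text \<open>
  Ulam-Harris encoding: the root is \<open>[]\<close>, and \<open>v @ [(i, j)]\<close> is the child number \<open>j\<close>
  (counted from \<open>0\<close>) of \<open>v\<close> among those joined to \<open>v\<close> by an edge of color \<open>i\<close>. The descendants of
  \<open>v\<close> (including \<open>v\<close>) are thus the vertices having \<open>v\<close> as a prefix.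
\<close>

type_synonym node = "(nat \<times> nat) list"

text \<open>
  Joint law of the offspring counts \<open>X (v, i)\<close>. These are assigned to all potential nodes,
  also to those that do not occur in the resulting tree.
\<close>

definition offspring_space :: "nat \<Rightarrow> (nat \<Rightarrow> real) \<Rightarrow> (node \<times> nat \<Rightarrow> nat) measure" where
  "offspring_space k lam =
     (\<Pi>\<^sub>M (v, i)\<in>UNIV \<times> {1..k}. measure_pmf (poisson_pmf (lam i)))"

inductive_set tree_nodes :: "nat \<Rightarrow> (node \<times> nat \<Rightarrow> nat) \<Rightarrow> node set"
  for k :: nat and X :: "node \<times> nat \<Rightarrow> nat" where
  root: "[] \<in> tree_nodes k X"
| child: "v \<in> tree_nodes k X \<Longrightarrow> i \<in> {1..k} \<Longrightarrow> j < X (v, i) \<Longrightarrow> v @ [(i, j)] \<in> tree_nodes k X"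

definition ecbp_tree :: "nat \<Rightarrow> (node \<times> nat \<Rightarrow> nat) \<Rightarrow> node ecgraph" where
  "ecbp_tree k X =
     (tree_nodes k X,
      \<lambda>i. {{v, v @ [(i, j)]} | v j. v \<in> tree_nodes k X \<and> v @ [(i, j)] \<in> tree_nodes k X})"

definition avoiding_connected_infinity :: "nat \<Rightarrow> node ecgraph \<Rightarrow> nat \<Rightarrow> node \<Rightarrow> bool" where
  "avoiding_connected_infinity k G i v \<longleftrightarrow>
     (\<exists>p :: nat \<Rightarrow> node. p 0 = v \<and> inj p \<and>
        (\<forall>m. p m \<in> vertices G \<and> prefix v (p m) \<and>
             {p m, p (Suc m)} \<in> edges_of_colors G ({1..k} - {i})))"

definition avoiding_friends :: "nat \<Rightarrow> node ecgraph \<Rightarrow> nat \<Rightarrow> node \<Rightarrow> node \<Rightarrow> bool" where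
  "avoiding_friends k G i r v \<longleftrightarrow>
     avoiding_connected k G i r v \<or>
     (avoiding_connected_infinity k G i r \<and> avoiding_connected_infinity k G i v)"

definition root_friends :: "nat \<Rightarrow> node ecgraph \<Rightarrow> node set" where
  "root_friends k G = {v \<in> vertices G. \<forall>i\<in>{1..k}. avoiding_friends k G i [] v}"

text \<open>
  The event below is measurable: the tree is locally finite, so by Koenig's lemma an infinite
  descending path exists iff there are descending paths of every finite length.
\<close>

definition f_infinity :: "nat \<Rightarrow> (nat \<Rightarrow> real) \<Rightarrow> real" where
  "f_infinity k lam =
     measure (offspring_space k lam)
       {X \<in> space (offspring_space k lam). infinite (root_friends k (ecbp_tree k X))}"

end

theory Submission
  imports Defs "HOL-Real_Asymp.Real_Asymp"
begin

text \<open>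
  Write \<open>\<mu>\<^sub>i\<close> for the sum of all rates except \<open>lam i\<close>. The hypothesis on \<open>f_infinity\<close> forces every
  \<open>\<mu>\<^sub>i\<close> above \<open>1\<close>: if the root has infinitely many friends, then the subtree of the root that avoids color
  \<open>i\<close> is infinite, and this subtree is a branching process with Poisson offspring of mean \<open>\<mu>\<^sub>i\<close>, which
  dies out if \<open>\<mu>\<^sub>i \<le> 1\<close> (\<open>supercritical_if_infinite_friends\<close>). So all the graphs obtained by deleting one
  color are supercritical Erdos-Renyi graphs.

  Fix a small \<open>\<kappa> > 0\<close> and call a cluster (a connected component after deletion of one color) large if it
  has at least \<open>\<kappa> n\<close> vertices. With probability tending to one, the following two things happen.

  \<^item> For each \<open>i\<close> there is at most one large cluster without color \<open>i\<close> (\<open>two_large_clusters_unlikely\<close>).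
    If there were two, then inserting any of the order \<open>n\<^sup>2\<close> edges of another color \<open>j\<close> between them would
    raise the mean cluster size divided by \<open>n\<close> by at least a constant. But the sum over all edges of color \<open>j\<close> of the expected
    effect of the edge on a function with values in \<open>[0, 1]\<close> is, up to a factor of order \<open>n\<close>, the covariance of
    this function with the number of edges of color \<open>j\<close>, and that number has a standard deviation of order
    \<open>sqrt n\<close> only.

  \<^item> At least \<open>\<kappa> n\<close> vertices lie in large clusters for all \<open>i\<close> at once (\<open>jointly_large_likely\<close>). An
    exponential supermartingale for the exploration of a cluster (\<open>exploration_bound\<close>) shows that the
    cluster of a vertex is large with probability bounded below, and that clusters which are neither
    bounded nor large are rare. The Harris inequality turns the first fact into a linear lower bound on
    the expected number of vertices whose clusters are large for all \<open>i\<close>. By the second fact, that number is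
    close to the number of vertices all of whose clusters have size at least \<open>L\<close>, for a large
    constant \<open>L\<close>; one edge changes the latter count by a bounded amount only, hence it is
    concentrated by the Efron-Stein inequality.

  On these events, the vertices that lie in large clusters for all \<open>i\<close> are pairwise color-avoiding
  connected, and every color-avoiding connected component with at least \<open>\<kappa> n\<close> vertices is the one that contains
  them (\<open>unique_largest_component\<close>).
\<close>

section \<open>Expectations over random subsets of a finite set\<close>

text \<open>
  The expectation of \<open>f\<close> at the random subset of \<open>I\<close> that contains each \<open>i\<close> independently with
  probability \<open>p i\<close>. Written as a finite sum, it needs no measurability or integrability conditions and
  lends itself to induction on \<open>I\<close>.
\<close>

definition bexp :: "('a \<Rightarrow> real) \<Rightarrow> 'a set \<Rightarrow> ('a set \<Rightarrow> real) \<Rightarrow> real" where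
  "bexp p I f = (\<Sum>S\<in>Pow I. (\<Prod>i\<in>I. if i \<in> S then p i else 1 - p i) * f S)"

lemma bexp_empty [simp]: "bexp p {} f = f {}"
  by (simp add: bexp_def)

lemma bexp_cong:
  assumes "\<And>S. S \<subseteq> I \<Longrightarrow> f S = g S"
  shows "bexp p I f = bexp p I g"
  unfolding bexp_def using assms by (intro sum.cong) auto

lemma bexp_insert:
  assumes "finite I" "x \<notin> I"
  shows "bexp p (insert x I) f =
    p x * bexp p I (\<lambda>S. f (insert x S)) + (1 - p x) * bexp p I f"
proof -
  let ?w = "\<lambda>J S. \<Prod>i\<in>J. if i \<in> S then p i else 1 - p i"
  have inj: "inj_on (insert x) (Pow I)"
    using assms(2) by (auto simp: inj_on_def)
  have disj: "Pow I \<inter> insert x ` Pow I = {}"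
    using assms(2) by auto
  have w1: "?w (insert x I) (insert x S) = p x * ?w I S" if "S \<in> Pow I" for S
  proof -
    have "?w I (insert x S) = ?w I S"
      using assms(2) by (intro prod.cong) auto
    then show ?thesis using assms by simp
  qed
  have w0: "?w (insert x I) S = (1 - p x) * ?w I S" if "S \<in> Pow I" for S
    using assms that by auto
  have "bexp p (insert x I) f =
    (\<Sum>S\<in>Pow I. ?w (insert x I) S * f S) +
    (\<Sum>S\<in>insert x ` Pow I. ?w (insert x I) S * f S)"
    unfolding bexp_def Pow_insert using assms(1) disj
    by (intro sum.union_disjoint) auto
  also have "(\<Sum>S\<in>insert x ` Pow I. ?w (insert x I) S * f S)
    = (\<Sum>S\<in>Pow I. ?w (insert x I) (insert x S) * f (insert x S))"
    by (simp add: sum.reindex[OF inj])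
  also have "\<dots> = p x * bexp p I (\<lambda>S. f (insert x S))"
    unfolding bexp_def sum_distrib_left by (intro sum.cong refl) (subst w1, auto simp: mult_ac)
  also have "(\<Sum>S\<in>Pow I. ?w (insert x I) S * f S) = (1 - p x) * bexp p I f"
    unfolding bexp_def sum_distrib_left by (intro sum.cong refl) (subst w0, auto simp: mult_ac)
  finally show ?thesis by simp
qed

lemma bexp_add: "bexp p I (\<lambda>S. f S + g S) = bexp p I f + bexp p I g"
  by (simp add: bexp_def distrib_left sum.distrib)

lemma bexp_diff: "bexp p I (\<lambda>S. f S - g S) = bexp p I f - bexp p I g"
  by (simp add: bexp_def right_diff_distrib sum_subtractf)

lemma bexp_cmult: "bexp p I (\<lambda>S. c * f S) = c * bexp p I f"
  by (simp add: bexp_def sum_distrib_left mult_ac)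

lemma bexp_sum: "bexp p I (\<lambda>S. \<Sum>j\<in>J. f j S) = (\<Sum>j\<in>J. bexp p I (f j))"
  unfolding bexp_def by (simp add: sum_distrib_left) (rule sum.swap)

lemma bexp_const [simp]:
  assumes "finite I"
  shows "bexp p I (\<lambda>S. c) = c"
  using assms by (induction I) (auto simp: bexp_insert algebra_simps)

lemma bexp_mono:
  assumes "\<And>i. i \<in> I \<Longrightarrow> p i \<in> {0..1}" "\<And>S. S \<subseteq> I \<Longrightarrow> f S \<le> g S"
  shows "bexp p I f \<le> bexp p I g"
  unfolding bexp_def using assms by (intro sum_mono mult_left_mono prod_nonneg) auto

lemma bexp_nonneg:
  assumes "\<And>i. i \<in> I \<Longrightarrow> p i \<in> {0..1}" "\<And>S. S \<subseteq> I \<Longrightarrow> 0 \<le> f S"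
  shows "0 \<le> bexp p I f"
  unfolding bexp_def using assms by (intro sum_nonneg mult_nonneg_nonneg prod_nonneg) auto

lemma bexp_le_const:
  assumes "finite I" "\<And>i. i \<in> I \<Longrightarrow> p i \<in> {0..1}" "\<And>S. S \<subseteq> I \<Longrightarrow> f S \<le> c"
  shows "bexp p I f \<le> c"
  using bexp_mono[of I p f "\<lambda>_. c"] assms by simp

lemma bexp_Un:
  assumes "finite I" "finite J" "I \<inter> J = {}"
  shows "bexp p (I \<union> J) f = bexp p I (\<lambda>A. bexp p J (\<lambda>B. f (A \<union> B)))"
  using assms
proof (induction I arbitrary: f)
  case empty
  then show ?case by simp
next
  case (insert x I)
  have 1: "bexp p (insert x I \<union> J) f =
     p x * bexp p (I \<union> J) (\<lambda>S. f (insert x S)) + (1 - p x) * bexp p (I \<union> J) f"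
    using insert.prems insert.hyps by (simp add: bexp_insert)
  show ?case
    unfolding 1 using insert by (simp add: bexp_insert)
qed

lemma bexp_local:
  assumes "finite I" "J \<subseteq> I" "\<And>S. S \<subseteq> I \<Longrightarrow> f S = f (S \<inter> J)"
  shows "bexp p I f = bexp p J f"
proof -
  have fin: "finite J" "finite (I - J)" using assms finite_subset by auto
  have "I = J \<union> (I - J)" using assms by auto
  then have "bexp p I f = bexp p J (\<lambda>A. bexp p (I - J) (\<lambda>B. f (A \<union> B)))"
    using bexp_Un[OF fin, of p f] by auto
  also have "\<dots> = bexp p J (\<lambda>A. bexp p (I - J) (\<lambda>B. f A))"
  proof (intro bexp_cong)
    fix A B assume AB: "A \<subseteq> J" "B \<subseteq> I - J"
    then have "f (A \<union> B) = f ((A \<union> B) \<inter> J)" using assms by (intro assms(3)) auto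
    also have "(A \<union> B) \<inter> J = A" using AB by auto
    finally show "f (A \<union> B) = f A" .
  qed
  finally show ?thesis using fin by simp
qed

lemma bexp_eq_empty:
  assumes "finite J"
  shows "bexp p J (\<lambda>S. if S = {} then u else v) = v + (u - v) * (\<Prod>i\<in>J. 1 - p i)"
  using assms
proof (induction J)
  case empty then show ?case by simp
next
  case (insert x J)
  have "bexp p J (\<lambda>S. if insert x S = {} then u else v) = v"
    using insert.hyps by simp
  then show ?case
    using insert by (simp add: bexp_insert) (simp add: algebra_simps)
qed

lemma bexp_power_card:
  assumes "finite J" "\<And>x. x \<in> J \<Longrightarrow> p x = q"
  shows "bexp p J (\<lambda>S. z ^ card S) = (1 - q + q * z) ^ card J"
  using assms
proof (induction J)
  case empty then show ?case by simp
next
  case (insert x J)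
  have "bexp p J (\<lambda>S. z ^ card (insert x S)) = bexp p J (\<lambda>S. z * z ^ card S)"
  proof (intro bexp_cong)
    fix S assume "S \<subseteq> J"
    then have "finite S" "x \<notin> S" using insert finite_subset by auto
    then show "z ^ card (insert x S) = z * z ^ card S" by simp
  qed
  then show ?case using insert by (simp add: bexp_insert bexp_cmult algebra_simps)
qed

text \<open>
  Increasing functions are positively correlated. Conditioning on a new element \<open>x\<close> reduces this to the two-point
  case, in which the covariance is \<open>p x * (1 - p x)\<close> times the product of the two increments.
\<close>

lemma harris:
  assumes "finite I" "\<And>i. i \<in> I \<Longrightarrow> p i \<in> {0..1}"
    and "\<And>S T. S \<subseteq> T \<Longrightarrow> T \<subseteq> I \<Longrightarrow> f S \<le> f T"
    and "\<And>S T. S \<subseteq> T \<Longrightarrow> T \<subseteq> I \<Longrightarrow> g S \<le> g T"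
  shows "bexp p I f * bexp p I g \<le> bexp p I (\<lambda>S. f S * g S)"
  using assms
proof (induction I arbitrary: f g)
  case empty then show ?case by simp
next
  case (insert x I)
  define f1 g1 where "f1 = (\<lambda>S. f (insert x S))" and "g1 = (\<lambda>S. g (insert x S))"
  have p: "0 \<le> p x" "p x \<le> 1" "\<And>i. i \<in> I \<Longrightarrow> p i \<in> {0..1}"
    using insert.prems(1) by auto
  have mf: "\<And>S T. S \<subseteq> T \<Longrightarrow> T \<subseteq> insert x I \<Longrightarrow> f S \<le> f T"
    and mg: "\<And>S T. S \<subseteq> T \<Longrightarrow> T \<subseteq> insert x I \<Longrightarrow> g S \<le> g T"
    using insert.prems by auto
  have 1: "bexp p I f1 * bexp p I g1 \<le> bexp p I (\<lambda>S. f1 S * g1 S)"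
    using p insert.hyps unfolding f1_def g1_def by (intro insert.IH mf mg) auto
  have 0: "bexp p I f * bexp p I g \<le> bexp p I (\<lambda>S. f S * g S)"
    using p insert.hyps by (intro insert.IH mf mg) auto
  have df: "bexp p I f \<le> bexp p I f1" and dg: "bexp p I g \<le> bexp p I g1"
    using p unfolding f1_def g1_def by (auto intro!: bexp_mono mf mg)
  let ?a = "bexp p I f1" and ?b = "bexp p I f" and ?c = "bexp p I g1" and ?d = "bexp p I g"
  have "(p x * ?a + (1 - p x) * ?b) * (p x * ?c + (1 - p x) * ?d)
     = p x * (?a * ?c) + (1 - p x) * (?b * ?d) - p x * (1 - p x) * ((?a - ?b) * (?c - ?d))"
    by (simp add: algebra_simps)
  also have "\<dots> \<le> p x * (?a * ?c) + (1 - p x) * (?b * ?d)"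
    using p df dg by (simp add: mult_nonneg_nonneg)
  also have "\<dots> \<le> p x * bexp p I (\<lambda>S. f1 S * g1 S) + (1 - p x) * bexp p I (\<lambda>S. f S * g S)"
    using p 0 1 by (intro add_mono mult_left_mono) auto
  finally show ?case
    using insert.hyps by (simp add: bexp_insert f1_def g1_def)
qed

lemma harris_prod:
  assumes "finite I" "\<And>i. i \<in> I \<Longrightarrow> p i \<in> {0..1}" "finite J"
    and "\<And>j S T. j \<in> J \<Longrightarrow> S \<subseteq> T \<Longrightarrow> T \<subseteq> I \<Longrightarrow> f j S \<le> f j T"
    and "\<And>j S. j \<in> J \<Longrightarrow> S \<subseteq> I \<Longrightarrow> 0 \<le> f j S"
  shows "(\<Prod>j\<in>J. bexp p I (f j)) \<le> bexp p I (\<lambda>S. \<Prod>j\<in>J. f j S)"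
  using assms(3-)
proof (induction J)
  case empty then show ?case using assms(1) by simp
next
  case (insert j J)
  have mono: "\<And>j' S T. j' \<in> insert j J \<Longrightarrow> S \<subseteq> T \<Longrightarrow> T \<subseteq> I \<Longrightarrow> f j' S \<le> f j' T"
    and nonneg: "\<And>j' S. j' \<in> insert j J \<Longrightarrow> S \<subseteq> I \<Longrightarrow> 0 \<le> f j' S"
    using insert.prems by auto
  have "(\<Prod>j\<in>insert j J. bexp p I (f j)) = bexp p I (f j) * (\<Prod>j\<in>J. bexp p I (f j))"
    using insert.hyps by simp
  also have "\<dots> \<le> bexp p I (f j) * bexp p I (\<lambda>S. \<Prod>j\<in>J. f j S)"
    using assms(2) nonneg mono by (intro mult_left_mono insert.IH bexp_nonneg) auto
  also have "\<dots> \<le> bexp p I (\<lambda>S. f j S * (\<Prod>j\<in>J. f j S))"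
    using assms(1,2) mono nonneg by (intro harris prod_mono) (auto intro!: mono nonneg)
  finally show ?case using insert.hyps by simp
qed

text \<open>
  Averaging over a new element \<open>y\<close> splits the variance of \<open>f\<close> into the expected variance in the direction of \<open>y\<close>, which
  is the new term on the right, and the variance of the average \<open>g\<close>. The terms of the sum for \<open>g\<close> are at
  most those for \<open>f\<close>, by convexity of the square.
\<close>

lemma efron_stein:
  assumes "finite I" "\<And>i. i \<in> I \<Longrightarrow> p i \<in> {0..1}"
  shows "bexp p I (\<lambda>S. (f S)\<^sup>2) - (bexp p I f)\<^sup>2 \<le>
    (\<Sum>x\<in>I. p x * (1 - p x) * bexp p I (\<lambda>S. (f (insert x S) - f (S - {x}))\<^sup>2))"
  using assms
proof (induction I arbitrary: f)
  case empty then show ?case by simp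
next
  case (insert y I)
  define q where "q = p y"
  have q: "0 \<le> q" "q \<le> 1" and p: "\<And>i. i \<in> I \<Longrightarrow> p i \<in> {0..1}"
    using insert.prems(1) by (auto simp: q_def)
  have fin: "finite I" "y \<notin> I" using insert.hyps by auto
  define f1 where "f1 = (\<lambda>S. f (insert y S))"
  define g where "g = (\<lambda>S. q * f1 S + (1 - q) * f S)"
  let ?D = "\<lambda>h x S. (h (insert x S) - h (S - {x}) :: real)"
  have g: "bexp p I g = bexp p (insert y I) f"
    using fin by (simp add: bexp_insert g_def f1_def q_def bexp_add bexp_cmult)
  have "bexp p (insert y I) (\<lambda>S. (f S)\<^sup>2) =
      bexp p I (\<lambda>S. q * (f1 S)\<^sup>2 + (1 - q) * (f S)\<^sup>2)"
    using fin by (simp add: bexp_insert f1_def q_def bexp_add bexp_cmult)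
  also have "\<dots> = bexp p I (\<lambda>S. (g S)\<^sup>2 + q * (1 - q) * (f1 S - f S)\<^sup>2)"
    by (intro bexp_cong) (simp add: g_def power2_eq_square algebra_simps)
  also have "\<dots> = bexp p I (\<lambda>S. (g S)\<^sup>2) + q * (1 - q) * bexp p I (\<lambda>S. (f1 S - f S)\<^sup>2)"
    by (simp add: bexp_add bexp_cmult)
  finally have e1: "bexp p (insert y I) (\<lambda>S. (f S)\<^sup>2) - (bexp p (insert y I) f)\<^sup>2 =
     bexp p I (\<lambda>S. (g S)\<^sup>2) - (bexp p I g)\<^sup>2 + q * (1 - q) * bexp p I (\<lambda>S. (f1 S - f S)\<^sup>2)"
    by (simp add: g)
  have Dy: "bexp p (insert y I) (\<lambda>S. (?D f y S)\<^sup>2) = bexp p I (\<lambda>S. (f1 S - f S)\<^sup>2)"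
  proof -
    have "bexp p (insert y I) (\<lambda>S. (?D f y S)\<^sup>2) =
       q * bexp p I (\<lambda>S. (?D f y (insert y S))\<^sup>2) + (1 - q) * bexp p I (\<lambda>S. (?D f y S)\<^sup>2)"
      using fin by (simp add: bexp_insert q_def)
    also have "bexp p I (\<lambda>S. (?D f y (insert y S))\<^sup>2) = bexp p I (\<lambda>S. (f1 S - f S)\<^sup>2)"
    proof (intro bexp_cong)
      fix S assume "S \<subseteq> I"
      then have "S - {y} = S" using fin by auto
      then show "(?D f y (insert y S))\<^sup>2 = (f1 S - f S)\<^sup>2" by (simp add: f1_def)
    qed
    also have "bexp p I (\<lambda>S. (?D f y S)\<^sup>2) = bexp p I (\<lambda>S. (f1 S - f S)\<^sup>2)"
    proof (intro bexp_cong)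
      fix S assume "S \<subseteq> I"
      then have "S - {y} = S" using fin by auto
      then show "(?D f y S)\<^sup>2 = (f1 S - f S)\<^sup>2" by (simp add: f1_def)
    qed
    finally show ?thesis by (simp add: algebra_simps)
  qed
  have Dx: "bexp p I (\<lambda>S. (?D g x S)\<^sup>2) \<le> bexp p (insert y I) (\<lambda>S. (?D f x S)\<^sup>2)" if "x \<in> I" for x
  proof -
    have "x \<noteq> y" using that fin by auto
    have "bexp p I (\<lambda>S. (?D g x S)\<^sup>2) \<le> bexp p I (\<lambda>S. q * (?D f1 x S)\<^sup>2 + (1 - q) * (?D f x S)\<^sup>2)"
    proof (intro bexp_mono p)
      fix S
      have "q * (?D f1 x S)\<^sup>2 + (1 - q) * (?D f x S)\<^sup>2 - (?D g x S)\<^sup>2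
         = q * (1 - q) * (?D f1 x S - ?D f x S)\<^sup>2"
        by (simp add: g_def power2_eq_square algebra_simps)
      also have "\<dots> \<ge> 0" using q by simp
      finally show "(?D g x S)\<^sup>2 \<le> q * (?D f1 x S)\<^sup>2 + (1 - q) * (?D f x S)\<^sup>2" by simp
    qed
    also have "\<dots> = bexp p (insert y I) (\<lambda>S. (?D f x S)\<^sup>2)"
    proof -
      have "?D f1 x S = ?D f x (insert y S)" for S
        using \<open>x \<noteq> y\<close> by (auto simp: f1_def insert_commute insert_Diff_if)
      then show ?thesis using fin by (simp add: bexp_insert bexp_add bexp_cmult q_def)
    qed
    finally show ?thesis .
  qed
  have "bexp p I (\<lambda>S. (g S)\<^sup>2) - (bexp p I g)\<^sup>2 \<le>
     (\<Sum>x\<in>I. p x * (1 - p x) * bexp p I (\<lambda>S. (?D g x S)\<^sup>2))"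
    using p by (rule insert.IH)
  also have "\<dots> \<le> (\<Sum>x\<in>I. p x * (1 - p x) * bexp p (insert y I) (\<lambda>S. (?D f x S)\<^sup>2))"
    using p Dx by (intro sum_mono mult_left_mono) auto
  finally show ?case using fin e1 Dy by (simp add: q_def)
qed

lemma bexp_covariance:
  assumes "finite I" "x \<in> I"
  shows "bexp p I (\<lambda>S. f S * (of_bool (x \<in> S) - p x)) =
    p x * (1 - p x) * bexp p I (\<lambda>S. f (insert x S) - f (S - {x}))"
proof -
  define J where "J = I - {x}"
  have I: "I = insert x J" "x \<notin> J" "finite J" using assms by (auto simp: J_def)
  have c1: "bexp p J (\<lambda>S. f S * (of_bool (x \<in> S) - p x)) = bexp p J (\<lambda>S. - p x * f S)"
    using I by (intro bexp_cong) auto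
  have Diff: "S - {x} = S" if "S \<subseteq> J" for S using that I by auto
  have c3: "bexp p J (\<lambda>S. f (insert x (insert x S)) - f (insert x S - {x}))
     = bexp p J (\<lambda>S. f (insert x S) - f S)"
    by (intro bexp_cong) (simp add: Diff)
  have c4: "bexp p J (\<lambda>S. f (insert x S) - f (S - {x})) = bexp p J (\<lambda>S. f (insert x S) - f S)"
    by (intro bexp_cong) (simp add: Diff)
  have c2: "bexp p J (\<lambda>S. f (insert x S) * (of_bool (x \<in> insert x S) - p x))
     = bexp p J (\<lambda>S. (1 - p x) * f (insert x S))"
    by (intro bexp_cong) simp
  show ?thesis
    unfolding I(1) bexp_insert[OF I(3,2)] c1 c2 c3 c4
    unfolding bexp_diff bexp_cmult by (simp add: algebra_simps)
qed

text \<open>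
  Merging the colors in \<open>C\<close> of a random edge-colored graph gives a random uncolored graph: the presence of
  an edge \<open>e\<close> in \<open>S `` C\<close> depends only on the slots \<open>(c, e)\<close> with \<open>c \<in> C\<close>, and these are disjoint
  for different \<open>e\<close>.
\<close>

lemma bexp_color_union:
  fixes p :: "'c \<times> 'e \<Rightarrow> real" and \<pi> :: "'c \<Rightarrow> real"
  assumes "finite K" "finite N" "C \<subseteq> K" "\<And>c e. p (c, e) = \<pi> c"
  shows "bexp p (K \<times> N) (\<lambda>S. f (S `` C)) = bexp (\<lambda>_. 1 - (\<Prod>c\<in>C. 1 - \<pi> c)) N f"
  using assms(2)
proof (induction N arbitrary: f)
  case empty
  then show ?case by simp
next
  case (insert e N)
  have fin: "finite C" "finite (C \<times> {e})" using assms finite_subset by blast+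
  have "K \<times> insert e N = K \<times> N \<union> K \<times> {e}" by auto
  moreover have "K \<times> N \<inter> K \<times> {e} = {}" using insert by auto
  ultimately have "bexp p (K \<times> insert e N) (\<lambda>S. f (S `` C)) =
     bexp p (K \<times> N) (\<lambda>A. bexp p (K \<times> {e}) (\<lambda>B. f ((A \<union> B) `` C)))"
    using insert.hyps assms(1) by (simp add: bexp_Un)
  also have "\<dots> = bexp p (K \<times> N) (\<lambda>A. (\<lambda>E. (1 - (\<Prod>c\<in>C. 1 - \<pi> c)) * f (insert e E)
       + (\<Prod>c\<in>C. 1 - \<pi> c) * f E) (A `` C))"
  proof (intro bexp_cong)
    fix A
    have "bexp p (K \<times> {e}) (\<lambda>B. f ((A \<union> B) `` C)) =
      bexp p (K \<times> {e}) (\<lambda>B. if B \<inter> (C \<times> {e}) = {} then f (A `` C) else f (insert e (A `` C)))"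
    proof (intro bexp_cong)
      fix B assume "B \<subseteq> K \<times> {e}"
      then have "(A \<union> B) `` C = (if B \<inter> (C \<times> {e}) = {} then A `` C else insert e (A `` C))"
        by auto
      then show "f ((A \<union> B) `` C) =
        (if B \<inter> (C \<times> {e}) = {} then f (A `` C) else f (insert e (A `` C)))" by simp
    qed
    also have "\<dots> = bexp p (C \<times> {e})
      (\<lambda>B. if B \<inter> (C \<times> {e}) = {} then f (A `` C) else f (insert e (A `` C)))"
      using assms by (intro bexp_local) auto
    also have "\<dots> = bexp p (C \<times> {e}) (\<lambda>B. if B = {} then f (A `` C) else f (insert e (A `` C)))"
      by (intro bexp_cong) (auto simp: Int_absorb2)
    also have "\<dots> = f (insert e (A `` C)) + (f (A `` C) - f (insert e (A `` C))) * (\<Prod>x\<in>C \<times> {e}. 1 - p x)"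
      using fin by (simp add: bexp_eq_empty)
    also have "(\<Prod>x\<in>C \<times> {e}. 1 - p x) = (\<Prod>c\<in>C. 1 - \<pi> c)"
      by (rule prod.reindex_bij_witness[of _ "\<lambda>c. (c, e)" fst]) (auto simp: assms(4))
    finally show "bexp p (K \<times> {e}) (\<lambda>B. f ((A \<union> B) `` C)) =
       (\<lambda>E. (1 - (\<Prod>c\<in>C. 1 - \<pi> c)) * f (insert e E) + (\<Prod>c\<in>C. 1 - \<pi> c) * f E) (A `` C)"
      by (simp add: algebra_simps)
  qed
  also have "\<dots> = bexp (\<lambda>_. 1 - (\<Prod>c\<in>C. 1 - \<pi> c)) (insert e N) f"
    unfolding insert.IH[of "\<lambda>E. (1 - (\<Prod>c\<in>C. 1 - \<pi> c)) * f (insert e E)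
       + (\<Prod>c\<in>C. 1 - \<pi> c) * f E"] using insert.hyps by (simp add: bexp_insert bexp_add bexp_cmult)
  finally show ?case .
qed

lemma Pi_bernoulli_expectation:
  assumes "finite I" "\<And>i. i \<in> I \<Longrightarrow> p i \<in> {0..1}"
  shows "measure_pmf.expectation (Pi_pmf I False (\<lambda>x. bernoulli_pmf (p x))) f
    = bexp p I (\<lambda>S. f (\<lambda>x. x \<in> S))"
proof -
  let ?M = "Pi_pmf I False (\<lambda>x. bernoulli_pmf (p x))"
  let ?h = "\<lambda>S x. x \<in> S"
  have inj: "inj_on ?h (Pow I)" by (auto simp: inj_on_def fun_eq_iff)
  have supp: "set_pmf ?M \<subseteq> ?h ` Pow I"
  proof
    fix \<omega> assume "\<omega> \<in> set_pmf ?M"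
    then have "\<omega> \<in> PiE_dflt I False (\<lambda>x. set_pmf (bernoulli_pmf (p x)))"
      using assms(1) by (simp only: set_Pi_pmf comp_def)
    then have "\<omega> = ?h {x\<in>I. \<omega> x}" by (auto simp: PiE_dflt_def fun_eq_iff)
    then show "\<omega> \<in> ?h ` Pow I" by blast
  qed
  have "measure_pmf.expectation ?M f = (\<Sum>\<omega>\<in>?h ` Pow I. f \<omega> * pmf ?M \<omega>)"
    using supp assms(1) by (intro integral_measure_pmf_real) auto
  also have "\<dots> = (\<Sum>S\<in>Pow I. f (?h S) * pmf ?M (?h S))"
    by (simp add: sum.reindex[OF inj])
  also have "\<dots> = bexp p I (\<lambda>S. f (?h S))"
    unfolding bexp_def
  proof (intro sum.cong refl)
    fix S assume S: "S \<in> Pow I"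
    have "pmf ?M (?h S) = (\<Prod>x\<in>I. pmf (bernoulli_pmf (p x)) (x \<in> S))"
      using S assms(1) by (intro pmf_Pi') auto
    also have "\<dots> = (\<Prod>x\<in>I. if x \<in> S then p x else 1 - p x)"
      using assms(2) by (intro prod.cong) auto
    finally show "f (?h S) * pmf ?M (?h S) = (\<Prod>x\<in>I. if x \<in> S then p x else 1 - p x) * f (?h S)"
      by simp
  qed
  finally show ?thesis .
qed

section \<open>Exploring a cluster of a random graph\<close>

definition cluster :: "'v set set \<Rightarrow> 'v \<Rightarrow> 'v set" where
  "cluster E v = {(x, y). {x, y} \<in> E}\<^sup>* `` {v}"

text \<open>
  The vertices of \<open>U\<close> that an exploration started from the active set \<open>A\<close> discovers when it may only
  step into the unexplored set \<open>U\<close>.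
\<close>

definition reach :: "'v set \<Rightarrow> 'v set \<Rightarrow> 'v set set \<Rightarrow> 'v set" where
  "reach A U E = {(x, y). {x, y} \<in> E \<and> y \<in> U}\<^sup>+ `` A"

lemma reach_subset: "reach A U E \<subseteq> U"
  unfolding reach_def by (auto elim: tranclE)

lemma reach_empty [simp]: "reach {} U E = {}"
  by (simp add: reach_def)

lemma reach_base: "x \<in> A \<Longrightarrow> y \<in> U \<Longrightarrow> {x, y} \<in> E \<Longrightarrow> y \<in> reach A U E"
  unfolding reach_def by blast

lemma reach_step: "x \<in> reach A U E \<Longrightarrow> y \<in> U \<Longrightarrow> {x, y} \<in> E \<Longrightarrow> y \<in> reach A U E"
  unfolding reach_def by (auto intro: trancl_into_trancl)

lemma reach_least:
  assumes "\<And>x y. x \<in> A \<union> R \<Longrightarrow> y \<in> U \<Longrightarrow> {x, y} \<in> E \<Longrightarrow> y \<in> R"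
  shows "reach A U E \<subseteq> R"
proof
  fix y assume "y \<in> reach A U E"
  then obtain a where a: "a \<in> A" "(a, y) \<in> {(x, y). {x, y} \<in> E \<and> y \<in> U}\<^sup>+"
    unfolding reach_def by blast
  from a(2) show "y \<in> R"
    by (induction rule: trancl_induct) (use a(1) assms in auto)
qed

text \<open>
  One exploration step: process the active vertex \<open>a\<close>, which is replaced by its neighbors in \<open>U\<close>. The rest of
  the exploration never looks at an edge at \<open>a\<close> again.
\<close>

lemma reach_explore:
  fixes E :: "'v set set"
  assumes "a \<in> A" "A \<inter> U = {}"
  defines "N \<equiv> {u \<in> U. {a, u} \<in> E}"
  shows "reach A U E = N \<union> reach (A - {a} \<union> N) (U - N) E"
proof
  let ?R = "reach (A - {a} \<union> N) (U - N) E"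
  show "reach A U E \<subseteq> N \<union> ?R"
  proof (rule reach_least)
    fix x y assume x: "x \<in> A \<union> (N \<union> ?R)" and y: "y \<in> U" and xy: "{x, y} \<in> E"
    show "y \<in> N \<union> ?R"
    proof (cases "y \<in> N \<or> x = a")
      case True
      then show ?thesis using xy y by (auto simp: N_def)
    next
      case False
      then have "y \<in> U - N" using y by auto
      moreover have "x \<in> (A - {a} \<union> N) \<union> ?R" using False x by auto
      ultimately have "y \<in> ?R" using xy by (metis Un_iff reach_base reach_step)
      then show ?thesis by simp
    qed
  qed
  have N: "N \<subseteq> reach A U E" using assms by (auto simp: N_def intro: reach_base)
  moreover have "?R \<subseteq> reach A U E"
  proof (rule reach_least)
    fix x y assume "x \<in> A - {a} \<union> N \<union> reach A U E" "y \<in> U - N" "{x, y} \<in> E"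
    then have "x \<in> A \<union> reach A U E" "y \<in> U" "{x, y} \<in> E" using N by auto
    then show "y \<in> reach A U E" by (metis Un_iff reach_base reach_step)
  qed
  ultimately show "N \<union> ?R \<subseteq> reach A U E" by blast
qed

lemma reach_cong:
  assumes "\<And>x y. x \<in> A \<union> U \<Longrightarrow> y \<in> U \<Longrightarrow> {x, y} \<in> E \<longleftrightarrow> {x, y} \<in> E'"
  shows "reach A U E = reach A U E'"
proof -
  have "reach A U F \<subseteq> reach A U F'"
    if "\<And>x y. x \<in> A \<union> U \<Longrightarrow> y \<in> U \<Longrightarrow> {x, y} \<in> F \<Longrightarrow> {x, y} \<in> F'" for F F' :: "'a set set"
  proof (rule reach_least)
    fix x y assume x: "x \<in> A \<union> reach A U F'" and y: "y \<in> U" "{x, y} \<in> F"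
    have "x \<in> A \<union> U" using x reach_subset[of A U F'] by blast
    then have "{x, y} \<in> F'" using y that by blast
    then show "y \<in> reach A U F'" using x y by (metis Un_iff reach_base reach_step)
  qed
  from this[of E E'] this[of E' E] show ?thesis using assms by blast
qed

text \<open>
  Processing an active vertex replaces it by a binomial number of new ones. As long as \<open>m\<close> vertices are
  unexplored, the hypothesis \<open>drift\<close> makes \<open>\<beta> ^ discovered * \<sigma> ^ active\<close> a supermartingale; it starts at
  \<open>\<sigma> ^ card A\<close>, and it ends at \<open>\<beta> ^ card (reach A U E)\<close> when the exploration runs out of active vertices.
  The truncation at \<open>l\<close> restricts the claim to explorations that end while \<open>m\<close> vertices are still
  unexplored. The bound has two uses: since \<open>\<beta> \<ge> 1\<close>, it gives an upper bound on the probability of early extinction;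
  and for \<open>\<beta> > 1\<close> it shows that a late, but not too late, extinction is exponentially unlikely.
\<close>

lemma exploration_bound:
  fixes p \<beta> \<sigma> :: real
  assumes "finite I" and p: "0 \<le> p" "p \<le> 1"
    and \<beta>: "1 \<le> \<beta>" and \<sigma>: "0 \<le> \<sigma>" "\<beta> * \<sigma> \<le> 1"
    and drift: "(1 - p + p * (\<beta> * \<sigma>)) ^ m \<le> \<sigma>"
    and "finite A" "finite U" "A \<inter> U = {}" "m + l \<le> card U"
    and "\<And>x y. x \<in> A \<union> U \<Longrightarrow> y \<in> U \<Longrightarrow> x \<noteq> y \<Longrightarrow> {x, y} \<in> I"
  shows "bexp (\<lambda>_. p) I (\<lambda>E. \<beta> ^ card (reach A U E) * of_bool (card (reach A U E) < l))
    \<le> \<sigma> ^ card A"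
  using assms(1) assms(8-)
\<comment> \<open>Each step removes one vertex from \<open>A\<close>; each discovered vertex adds one to \<open>A\<close> but lowers \<open>l\<close> by one.\<close>
proof (induction "2 * l + card A" arbitrary: l A U I rule: less_induct)
  case less
  note finI = less.prems(1) and finA = less.prems(2) and finU = less.prems(3)
    and disj = less.prems(4) and size = less.prems(5) and edges = less.prems(6)
  show ?case
  proof (cases "A = {}")
    case True
    have "bexp (\<lambda>_. p) I (\<lambda>E. \<beta> ^ card (reach A U E) * of_bool (card (reach A U E) < l)) \<le> 1"
      using True finI p by (intro bexp_le_const) auto
    then show ?thesis using True by simp
  next
    case False
    then obtain a where a: "a \<in> A" by blast
    define star where "star = (\<lambda>u. {a, u}) ` U"
    define s where "s = card A - 1"
    have cardA: "card A = Suc s" using card.remove[OF finA a] a finA by (simp add: s_def)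
    have inj: "inj_on (\<lambda>u. {a, u}) U" by (auto simp: inj_on_def doubleton_eq_iff)
    have star: "finite star" "star \<subseteq> I" "card star = card U"
      using finU a disj edges by (auto simp: star_def card_image[OF inj])
    define F where "F = (\<lambda>E. \<beta> ^ card (reach A U E) * of_bool (card (reach A U E) < l))"
    have inner: "bexp (\<lambda>_. p) (I - star) (\<lambda>E. F (B \<union> E)) \<le> \<sigma> ^ s * (\<beta> * \<sigma>) ^ card B"
      if B: "B \<subseteq> star" for B
    proof -
      define N where "N = {u \<in> U. {a, u} \<in> B}"
      have NU: "N \<subseteq> U" "finite N" using finU by (auto simp: N_def)
      have "B = (\<lambda>u. {a, u}) ` N" using B by (auto simp: N_def star_def)
      then have cardB: "card B = card N"
        using card_image[OF inj_on_subset[OF inj NU(1)]] by simp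
      define A' where "A' = A - {a} \<union> N"
      have cardA': "card A' = s + card N"
        unfolding A'_def using NU a disj finA cardA by (subst card_Un_disjoint) auto
      have F: "F (B \<union> E) = \<beta> ^ card N * (\<beta> ^ card (reach A' (U - N) E)
            * of_bool (card N + card (reach A' (U - N) E) < l))"
        if E: "E \<subseteq> I - star" for E
      proof -
        have N': "N = {u \<in> U. {a, u} \<in> B \<union> E}" using E by (auto simp: N_def star_def)
        have "reach A U (B \<union> E) = N \<union> reach A' (U - N) (B \<union> E)"
          unfolding A'_def N' by (rule reach_explore[OF a disj])
        also have "reach A' (U - N) (B \<union> E) = reach A' (U - N) E"
        proof (rule reach_cong)
          fix x y assume "x \<in> A' \<union> (U - N)" "y \<in> U - N"
          then have "x \<noteq> a" "y \<noteq> a" using a disj NU by (auto simp: A'_def)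
          then have "{x, y} \<notin> star" by (auto simp: star_def doubleton_eq_iff)
          then show "{x, y} \<in> B \<union> E \<longleftrightarrow> {x, y} \<in> E" using B by auto
        qed
        finally have *: "reach A U (B \<union> E) = N \<union> reach A' (U - N) E" .
        have "card (reach A U (B \<union> E)) = card N + card (reach A' (U - N) E)"
          unfolding * using NU finU reach_subset[of A' "U - N" E] finite_subset
          by (intro card_Un_disjoint) (blast, blast, blast)
        then show ?thesis by (simp add: F_def power_add)
      qed
      have eq: "bexp (\<lambda>_. p) (I - star) (\<lambda>E. F (B \<union> E)) = \<beta> ^ card N *
        bexp (\<lambda>_. p) (I - star) (\<lambda>E. \<beta> ^ card (reach A' (U - N) E)
            * of_bool (card N + card (reach A' (U - N) E) < l))"
        unfolding bexp_cmult[symmetric] by (rule bexp_cong) (rule F)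
      have "bexp (\<lambda>_. p) (I - star) (\<lambda>E. \<beta> ^ card (reach A' (U - N) E)
            * of_bool (card N + card (reach A' (U - N) E) < l)) \<le> \<sigma> ^ card A'"
      proof (cases "card N < l")
        case True
        have "bexp (\<lambda>_. p) (I - star) (\<lambda>E. \<beta> ^ card (reach A' (U - N) E)
            * of_bool (card (reach A' (U - N) E) < l - card N)) \<le> \<sigma> ^ card A'"
        proof (rule less.hyps)
          show "2 * (l - card N) + card A' < 2 * l + card A"
            using True cardA cardA' by simp
          show "m + (l - card N) \<le> card (U - N)"
            using size NU True by (simp add: card_Diff_subset)
          show "{x, y} \<in> I - star" if "x \<in> A' \<union> (U - N)" "y \<in> U - N" "x \<noteq> y" for x y
          proof -
            have "{x, y} \<in> I" using that edges NU by (auto simp: A'_def)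
            moreover have "x \<noteq> a" "y \<noteq> a" using that a disj NU by (auto simp: A'_def)
            then have "{x, y} \<notin> star" by (auto simp: star_def doubleton_eq_iff)
            ultimately show ?thesis by blast
          qed
        qed (use finI finA finU NU disj in \<open>auto simp: A'_def\<close>)
        moreover have "(card N + r < l) = (r < l - card N)" for r by auto
        ultimately show ?thesis by simp
      next
        case False
        then show ?thesis using \<sigma> finI by (simp add: bexp_const)
      qed
      then have "bexp (\<lambda>_. p) (I - star) (\<lambda>E. F (B \<union> E)) \<le> \<beta> ^ card N * \<sigma> ^ card A'"
        unfolding eq using \<beta> by (intro mult_left_mono) auto
      then show ?thesis by (simp add: cardA' cardB power_add power_mult_distrib mult_ac)
    qed
    have "I = star \<union> (I - star)" using star by auto
    then have "bexp (\<lambda>_. p) I F = bexp (\<lambda>_. p) star (\<lambda>B. bexp (\<lambda>_. p) (I - star) (\<lambda>E. F (B \<union> E)))"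
      using bexp_Un[of star "I - star" "\<lambda>_. p" F] star finI by auto
    also have "\<dots> \<le> bexp (\<lambda>_. p) star (\<lambda>B. \<sigma> ^ s * (\<beta> * \<sigma>) ^ card B)"
      using p inner by (intro bexp_mono) auto
    also have "\<dots> = \<sigma> ^ s * (1 - p + p * (\<beta> * \<sigma>)) ^ card U"
      using star by (simp add: bexp_cmult bexp_power_card[where q = p])
    also have "\<dots> \<le> \<sigma> ^ s * (1 - p + p * (\<beta> * \<sigma>)) ^ m"
    proof (intro mult_left_mono power_decreasing)
      show "m \<le> card U" using size by simp
      show "0 \<le> 1 - p + p * (\<beta> * \<sigma>)" using p \<beta> \<sigma> by (intro add_nonneg_nonneg) auto
      show "1 - p + p * (\<beta> * \<sigma>) \<le> 1" using p \<sigma> mult_left_mono[of "\<beta> * \<sigma>" 1 p] by simp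
      show "0 \<le> \<sigma> ^ s" using \<sigma> by simp
    qed
    also have "\<dots> \<le> \<sigma> ^ s * \<sigma>" using drift \<sigma> by (intro mult_left_mono) auto
    finally show ?thesis by (simp add: F_def cardA mult.commute)
  qed
qed

lemma cluster_conv_reach:
  assumes "E \<subseteq> nsets V 2"
  shows "cluster E v = insert v (reach {v} (V - {v}) E)"
proof
  show "cluster E v \<subseteq> insert v (reach {v} (V - {v}) E)"
  proof
    fix y assume "y \<in> cluster E v"
    then have "(v, y) \<in> {(x, y). {x, y} \<in> E}\<^sup>*" by (simp add: cluster_def)
    then show "y \<in> insert v (reach {v} (V - {v}) E)"
    proof (induction rule: rtrancl_induct)
      case base then show ?case by simp
    next
      case (step y z)
      have "{y, z} \<in> nsets V 2" using step.hyps(2) assms by blast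
      then have "z \<in> V" by (simp only: doubleton_in_nsets_2)
      moreover have "y = v \<or> y \<in> reach {v} (V - {v}) E" using step.IH by simp
      moreover have "{y, z} \<in> E" using step.hyps(2) by simp
      ultimately show ?case by (metis DiffI insertE insertI1 insert_iff reach_base reach_step singletonD)
    qed
  qed
  have "{(x, y). {x, y} \<in> E \<and> y \<in> V - {v}}\<^sup>+ \<subseteq> {(x, y). {x, y} \<in> E}\<^sup>*"
    (is "?T\<^sup>+ \<subseteq> ?S\<^sup>*")
  proof -
    have "?T\<^sup>* \<subseteq> ?S\<^sup>*" by (rule rtrancl_mono) auto
    then show ?thesis using trancl_into_rtrancl by fast
  qed
  then show "insert v (reach {v} (V - {v}) E) \<subseteq> cluster E v"
    by (auto simp: reach_def cluster_def)
qed

lemma cluster_tail_bound: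
  fixes p \<beta> \<sigma> :: real
  assumes "finite V" "v \<in> V" and p: "0 \<le> p" "p \<le> 1"
    and "1 \<le> \<beta>" "0 \<le> \<sigma>" "\<beta> * \<sigma> \<le> 1" "(1 - p + p * (\<beta> * \<sigma>)) ^ m \<le> \<sigma>"
    and size: "m + l < card V"
  shows "bexp (\<lambda>_. p) (nsets V 2) (\<lambda>E. \<beta> ^ (card (cluster E v) - 1)
      * of_bool (card (cluster E v) \<le> l)) \<le> \<sigma>"
proof -
  let ?R = "\<lambda>E. reach {v} (V - {v}) E"
  have "bexp (\<lambda>_. p) (nsets V 2) (\<lambda>E. \<beta> ^ (card (cluster E v) - 1)
      * of_bool (card (cluster E v) \<le> l))
    = bexp (\<lambda>_. p) (nsets V 2) (\<lambda>E. \<beta> ^ card (?R E) * of_bool (card (?R E) < l))"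
  proof (intro bexp_cong)
    fix E assume "E \<subseteq> nsets V 2"
    then have "cluster E v = insert v (?R E)" by (rule cluster_conv_reach)
    moreover have "?R E \<subseteq> V - {v}" by (rule reach_subset)
    moreover from this have "finite (?R E)" using assms(1) finite_subset by blast
    ultimately have "card (cluster E v) = Suc (card (?R E))" by (auto simp: card_insert_if)
    then show "\<beta> ^ (card (cluster E v) - 1) * of_bool (card (cluster E v) \<le> l)
      = \<beta> ^ card (?R E) * of_bool (card (?R E) < l)" by (simp add: Suc_le_eq)
  qed
  also have "\<dots> \<le> \<sigma> ^ card {v}"
    using assms by (intro exploration_bound) (auto intro: finite_imp_finite_nsets)
  finally show ?thesis by simp
qed

text \<open>
  The parameters come from \<open>r > 1\<close> with \<open>\<mu> = r ^ 4\<close>. With \<open>m\<close> about \<open>n / r\<close> unexplored vertices, the mean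
  number of discoveries in a step is about \<open>r ^ 3\<close>, hence at least \<open>r\<^sup>2\<close>. With \<open>\<sigma> = 1 / r\<close> and
  \<open>1 - \<beta> * \<sigma> = (r - 1) / r\<^sup>2\<close>, the drift condition reduces to \<open>exp (- (r - 1)) \<le> 1 / r\<close>; and \<open>\<beta> > 1\<close>
  because \<open>r + 1 / r > 2\<close>. All constants depend on \<open>\<mu>\<close> alone, so one choice serves several graphs.
\<close>

lemma supercritical_cluster:
  fixes \<mu> :: real
  assumes "\<mu> > 1"
  shows "\<exists>\<delta>>0. \<exists>\<beta>>1. \<exists>\<sigma>. 0 < \<sigma> \<and> \<sigma> < 1 \<and> (\<forall>\<^sub>F n in sequentially. \<forall>p (V :: 'v set) v.
    1 - exp (- \<mu> / real n) \<le> p \<longrightarrow> p \<le> 1 \<longrightarrow> finite V \<longrightarrow> card V = n \<longrightarrow> v \<in> V \<longrightarrow>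
    bexp (\<lambda>_. p) (nsets V 2) (\<lambda>E. \<beta> ^ (card (cluster E v) - 1)
      * of_bool (real (card (cluster E v)) \<le> \<delta> * real n)) \<le> \<sigma>)"
proof -
  define r where "r = root 4 \<mu>"
  have r: "r > 1" using assms by (simp add: r_def)
  have \<mu>: "\<mu> = r ^ 4" using assms by (simp add: r_def)
  define \<sigma> where "\<sigma> = 1 / r"
  define \<beta> where "\<beta> = r - 1 + 1 / r"
  define \<delta> where "\<delta> = (1 - 1 / r) / 4"
  have \<sigma>: "0 < \<sigma>" "\<sigma> < 1" using r by (auto simp: \<sigma>_def)
  have "\<beta> - 1 = (r - 1)\<^sup>2 / r" using r by (simp add: \<beta>_def field_simps power2_eq_square)
  also have "\<dots> > 0" using r by simp
  finally have \<beta>: "\<beta> > 1" by simp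
  have \<delta>: "\<delta> > 0" using r by (simp add: \<delta>_def)
  have \<beta>\<sigma>: "1 - \<beta> * \<sigma> = (r - 1) / r\<^sup>2"
    using r by (simp add: \<beta>_def \<sigma>_def field_simps power2_eq_square)
  have "((\<lambda>n. (1 - exp (- \<mu> / real n)) * (real n / r)) \<longlongrightarrow> \<mu> * inverse r) sequentially"
    using r by real_asymp
  moreover have "\<mu> * inverse r > r\<^sup>2" using r by (simp add: \<mu> field_simps power_strict_increasing flip: power_Suc)
  ultimately have ev1: "\<forall>\<^sub>F n in sequentially. r\<^sup>2 < (1 - exp (- \<mu> / real n)) * (real n / r)"
    by (rule order_tendstoD)
  have "\<forall>\<^sub>F n in sequentially. 2 < \<delta> * real n" using \<delta> by real_asymp
  then have "\<forall>\<^sub>F n in sequentially. \<forall>p (V :: 'v set) v.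
    1 - exp (- \<mu> / real n) \<le> p \<longrightarrow> p \<le> 1 \<longrightarrow> finite V \<longrightarrow> card V = n \<longrightarrow> v \<in> V \<longrightarrow>
    bexp (\<lambda>_. p) (nsets V 2) (\<lambda>E. \<beta> ^ (card (cluster E v) - 1)
      * of_bool (real (card (cluster E v)) \<le> \<delta> * real n)) \<le> \<sigma>"
    using ev1
  proof (eventually_elim, intro allI impI)
    fix n p and V :: "'v set" and v
    assume n: "2 < \<delta> * real n" "r\<^sup>2 < (1 - exp (- \<mu> / real n)) * (real n / r)"
      and p: "1 - exp (- \<mu> / real n) \<le> p" "p \<le> 1"
      and V: "finite V" "card V = n" "v \<in> V"
    define m where "m = nat \<lceil>real n / r\<rceil>"
    define l where "l = nat \<lfloor>\<delta> * real n\<rfloor>"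
    have m: "real n / r \<le> m" "m \<le> real n / r + 1"
      using r by (auto simp: m_def)
    have l: "real l \<le> \<delta> * real n" using \<delta> by (simp add: l_def)
    have "real n / r + 1 + \<delta> * real n < n"
    proof -
      have "real n / r = real n - 4 * (\<delta> * real n)" using r by (simp add: \<delta>_def field_simps)
      then show ?thesis using n(1) by linarith
    qed
    then have "m + l < card V" using m l V by linarith
    have "0 \<le> 1 - exp (- \<mu> / real n)" using assms by simp
    then have p0: "0 \<le> p" using p by linarith
    have "r\<^sup>2 \<le> p * real m"
      using n(2) mult_mono[OF p(1) m(1)] p0 r by simp
    then have "r\<^sup>2 * (1 - \<beta> * \<sigma>) \<le> p * real m * (1 - \<beta> * \<sigma>)"
      using r by (intro mult_right_mono) (auto simp: \<beta>\<sigma>)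
    then have pm: "r - 1 \<le> real m * (p * (1 - \<beta> * \<sigma>))"
      using r by (simp add: \<beta>\<sigma> mult_ac)
    have b: "0 \<le> \<beta> * \<sigma>" "0 \<le> 1 - \<beta> * \<sigma>"
      using \<beta> \<sigma> r by (auto simp: \<beta>\<sigma> simp del: diff_ge_0_iff_ge)
    have "(1 - p + p * (\<beta> * \<sigma>)) ^ m \<le> exp (- (p * (1 - \<beta> * \<sigma>))) ^ m"
    proof (rule power_mono)
      show "1 - p + p * (\<beta> * \<sigma>) \<le> exp (- (p * (1 - \<beta> * \<sigma>)))"
        using exp_ge_add_one_self[of "- (p * (1 - \<beta> * \<sigma>))"] by (simp add: algebra_simps)
      show "0 \<le> 1 - p + p * (\<beta> * \<sigma>)" using p p0 b by (intro add_nonneg_nonneg) auto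
    qed
    also have "\<dots> = exp (- (real m * (p * (1 - \<beta> * \<sigma>))))"
      by (simp add: exp_of_nat_mult[symmetric])
    also have "\<dots> \<le> exp (- (r - 1))" using pm by simp
    also have "\<dots> = 1 / exp (r - 1)" by (simp only: exp_minus inverse_eq_divide)
    also have "\<dots> \<le> 1 / r" using r exp_ge_add_one_self[of "r - 1"] by (intro divide_left_mono) auto
    finally have drift: "(1 - p + p * (\<beta> * \<sigma>)) ^ m \<le> \<sigma>" by (simp add: \<sigma>_def)
    have le: "(real (card (cluster E v)) \<le> \<delta> * real n) = (card (cluster E v) \<le> l)" for E
      using \<delta> by (simp add: l_def le_nat_floor le_nat_iff le_floor_iff)
    show "bexp (\<lambda>_. p) (nsets V 2) (\<lambda>E. \<beta> ^ (card (cluster E v) - 1)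
      * of_bool (real (card (cluster E v)) \<le> \<delta> * real n)) \<le> \<sigma>"
      unfolding le using V p p0 \<beta> \<sigma> b drift \<open>m + l < card V\<close>
      by (intro cluster_tail_bound[where m = m]) auto
  qed
  then show ?thesis using \<delta> \<beta> \<sigma> by blast
qed

section \<open>Clusters\<close>

lemma cluster_refl [simp]: "v \<in> cluster E v"
  by (simp add: cluster_def)

lemma cluster_mono: "E \<subseteq> F \<Longrightarrow> cluster E v \<subseteq> cluster F v"
  unfolding cluster_def by (intro Image_mono rtrancl_mono) auto

lemma cluster_edge: "x \<in> cluster E v \<Longrightarrow> {x, y} \<in> E \<Longrightarrow> y \<in> cluster E v"
  unfolding cluster_def by (auto intro: rtrancl_into_rtrancl)

lemma cluster_least:
  assumes "v \<in> R" "\<And>x y. x \<in> R \<Longrightarrow> {x, y} \<in> E \<Longrightarrow> y \<in> R"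
  shows "cluster E v \<subseteq> R"
proof
  fix y assume "y \<in> cluster E v"
  then have "(v, y) \<in> {(x, y). {x, y} \<in> E}\<^sup>*" by (simp add: cluster_def)
  then show "y \<in> R" by (induction rule: rtrancl_induct) (use assms in auto)
qed

lemma cluster_trans: "w \<in> cluster E v \<Longrightarrow> cluster E w \<subseteq> cluster E v"
  by (rule cluster_least) (auto intro: cluster_edge)

lemma cluster_sym: "w \<in> cluster E v \<Longrightarrow> v \<in> cluster E w"
proof -
  have "sym {(x, y). {x, y} \<in> E}" by (auto simp: sym_def insert_commute)
  then show "w \<in> cluster E v \<Longrightarrow> v \<in> cluster E w"
    unfolding cluster_def by (auto dest: sym_rtrancl[THEN symD])
qed

lemma cluster_eq: "w \<in> cluster E v \<Longrightarrow> cluster E w = cluster E v"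
  using cluster_trans cluster_sym by (metis subset_antisym)

lemma cluster_subset:
  assumes "E \<subseteq> nsets V 2" "v \<in> V"
  shows "cluster E v \<subseteq> V"
  using cluster_conv_reach[OF assms(1), of v] reach_subset[of "{v}" "V - {v}" E] assms(2) by auto

lemma cluster_insert_far:
  assumes "u \<notin> cluster E v" "w \<notin> cluster E v"
  shows "cluster (insert {u, w} E) v = cluster E v"
proof
  show "cluster (insert {u, w} E) v \<subseteq> cluster E v"
  proof (rule cluster_least)
    fix x y assume "x \<in> cluster E v" "{x, y} \<in> insert {u, w} E"
    then show "y \<in> cluster E v"
      using assms by (auto simp: doubleton_eq_iff intro: cluster_edge)
  qed simp
qed (intro cluster_mono subset_insertI)

lemma cluster_insert_join:
  "cluster E u \<union> cluster E w \<subseteq> cluster (insert {u, w} E) u"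
proof -
  let ?F = "insert {u, w} E"
  have "w \<in> cluster ?F u" by (rule cluster_edge[of u]) auto
  then have "cluster ?F w = cluster ?F u" by (rule cluster_eq)
  then show ?thesis using cluster_mono[of E ?F] by blast
qed

lemma nsets_Image: "S \<subseteq> K \<times> nsets V 2 \<Longrightarrow> S `` C \<subseteq> nsets V 2"
  by auto

lemma finite_cluster:
  assumes "finite V" "E \<subseteq> nsets V 2" "v \<in> V"
  shows "finite (cluster E v)" "card (cluster E v) \<le> card V"
  using cluster_subset[OF assms(2,3)] assms(1) finite_subset card_mono by auto

section \<open>At most one large cluster\<close>

definition two_large_clusters :: "'v set \<Rightarrow> real \<Rightarrow> 'v set set \<Rightarrow> bool" where
  "two_large_clusters V s E \<longleftrightarrow> (\<exists>u\<in>V. \<exists>w\<in>V.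
     s \<le> card (cluster E u) \<and> s \<le> card (cluster E w) \<and> w \<notin> cluster E u)"

text \<open>
  Joining two clusters \<open>P\<close> and \<open>Q\<close> enlarges the cluster of each vertex of \<open>P\<close> by \<open>card Q\<close> and that of each
  vertex of \<open>Q\<close> by \<open>card P\<close>.
\<close>

lemma susceptibility_increment:
  assumes V: "finite V" and E: "E \<subseteq> nsets V 2" and uw: "u \<in> V" "w \<in> V" "w \<notin> cluster E u"
  shows "(\<Sum>v\<in>V. real (card (cluster E v))) + 2 * real (card (cluster E u)) * real (card (cluster E w))
    \<le> (\<Sum>v\<in>V. real (card (cluster (insert {u, w} E) v)))"
proof -
  let ?F = "insert {u, w} E" and ?P = "cluster E u" and ?Q = "cluster E w"
  have "u \<noteq> w" using uw by auto
  then have F: "?F \<subseteq> nsets V 2" using E uw by auto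
  have sub: "?P \<subseteq> V" "?Q \<subseteq> V" using cluster_subset E uw by metis+
  have fin: "finite ?P" "finite ?Q" using sub V finite_subset by auto
  have disj: "?P \<inter> ?Q = {}"
    using uw(3) cluster_eq cluster_sym by (metis disjoint_iff cluster_refl)
  have PQ: "card (?P \<union> ?Q) = card ?P + card ?Q" using fin disj by (simp add: card_Un_disjoint)
  define h where "h = (\<lambda>v. real (card (cluster ?F v)) - real (card (cluster E v)))"
  have h0: "0 \<le> h v" if "v \<in> V" for v
    using finite_cluster(1)[OF V F that] cluster_mono[of E ?F v]
    by (auto simp: h_def intro!: card_mono)
  have joined: "?P \<union> ?Q \<subseteq> cluster ?F v" if "v \<in> ?P \<union> ?Q" for v
  proof -
    have "v \<in> cluster ?F u" using that cluster_insert_join[of E u w] by blast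
    then have "cluster ?F v = cluster ?F u" by (rule cluster_eq)
    then show ?thesis using cluster_insert_join[of E u w] by blast
  qed
  have large: "card ?P + card ?Q \<le> card (cluster ?F v)" if "v \<in> ?P \<union> ?Q" for v
  proof -
    have "v \<in> V" using that sub by auto
    then show ?thesis using card_mono[OF finite_cluster(1)[OF V F] joined[OF that]] PQ by simp
  qed
  have hP: "real (card ?Q) \<le> h v" if "v \<in> ?P" for v
    using large[of v] that cluster_eq[OF that] by (simp add: h_def)
  have hQ: "real (card ?P) \<le> h v" if "v \<in> ?Q" for v
    using large[of v] that cluster_eq[OF that] by (simp add: h_def)
  have "2 * real (card ?P) * real (card ?Q) = (\<Sum>v\<in>?P. real (card ?Q)) + (\<Sum>v\<in>?Q. real (card ?P))"
    by simp
  also have "\<dots> \<le> (\<Sum>v\<in>?P. h v) + (\<Sum>v\<in>?Q. h v)"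
    using hP hQ by (intro add_mono sum_mono) auto
  also have "\<dots> = (\<Sum>v\<in>?P \<union> ?Q. h v)" using fin disj by (simp add: sum.union_disjoint)
  also have "\<dots> \<le> (\<Sum>v\<in>V. h v)" using sub V h0 by (intro sum_mono2) auto
  finally show ?thesis by (simp add: h_def sum_subtractf)
qed

text \<open>
  A bounded function cannot have a large total influence: by \<open>bexp_covariance\<close>, the left-hand side is the
  covariance of \<open>f\<close> with \<open>card (S \<inter> J)\<close>, whose variance is the sum on the right. The Cauchy-Schwarz inequality
  appears in the form of the arithmetic-geometric mean inequality with a free weight \<open>a\<close>.
\<close>

lemma bexp_covariance_sum:
  assumes fin: "finite I" and p: "\<And>x. x \<in> I \<Longrightarrow> p x \<in> {0..1}" and J: "J \<subseteq> I"
    and f: "\<And>S. S \<subseteq> I \<Longrightarrow> \<bar>f S\<bar> \<le> 1" and a: "a > 0"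
  shows "(\<Sum>x\<in>J. p x * (1 - p x) * bexp p I (\<lambda>S. f (insert x S) - f (S - {x})))
    \<le> (a + (\<Sum>x\<in>J. p x * (1 - p x)) / a) / 2"
proof -
  define Z where "Z = (\<lambda>S. \<Sum>x\<in>J. of_bool (x \<in> S) - p x)"
  have finJ: "finite J" using J fin finite_subset by auto
  have cov: "bexp p I (\<lambda>S. g S * Z S) =
     (\<Sum>x\<in>J. p x * (1 - p x) * bexp p I (\<lambda>S. g (insert x S) - g (S - {x})))" for g
    unfolding Z_def sum_distrib_left bexp_sum using fin J
    by (intro sum.cong refl bexp_covariance) auto
  have Z0: "bexp p I Z = 0" using cov[of "\<lambda>_. 1"] fin by simp
  have DZ: "Z (insert x S) - Z (S - {x}) = of_bool (x \<in> J)" for x S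
  proof -
    have "Z (insert x S) - Z (S - {x}) = (\<Sum>y\<in>J. of_bool (y = x))"
      unfolding Z_def sum_subtractf[symmetric] by (intro sum.cong) auto
    then show ?thesis using finJ by (simp add: of_bool_def)
  qed
  have "bexp p I (\<lambda>S. (Z S)\<^sup>2) \<le>
      (\<Sum>x\<in>I. p x * (1 - p x) * bexp p I (\<lambda>S. (Z (insert x S) - Z (S - {x}))\<^sup>2))"
    using efron_stein[where p = p and f = Z, OF fin p] by (simp add: Z0)
  also have "\<dots> = (\<Sum>x\<in>I. if x \<in> J then p x * (1 - p x) else 0)"
    using fin by (intro sum.cong refl) (auto simp: DZ)
  also have "\<dots> = (\<Sum>x\<in>J. p x * (1 - p x))"
    using fin J by (simp add: sum.inter_restrict[symmetric] Int_absorb1)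
  finally have VZ: "bexp p I (\<lambda>S. (Z S)\<^sup>2) \<le> (\<Sum>x\<in>J. p x * (1 - p x))" .
  have "bexp p I (\<lambda>S. f S * Z S) \<le> bexp p I (\<lambda>S. a / 2 + 1 / (2 * a) * (Z S)\<^sup>2)"
  proof (rule bexp_mono[OF p])
    fix S assume S: "S \<subseteq> I"
    have "0 \<le> (a * f S - Z S)\<^sup>2" by simp
    then have "2 * a * (f S * Z S) \<le> a\<^sup>2 * (f S)\<^sup>2 + (Z S)\<^sup>2"
      by (simp add: power2_diff power_mult_distrib mult_ac)
    also have "\<dots> \<le> a\<^sup>2 * 1 + (Z S)\<^sup>2"
      using f[OF S] by (intro add_mono mult_left_mono) (auto simp: abs_square_le_1)
    finally show "f S * Z S \<le> a / 2 + 1 / (2 * a) * (Z S)\<^sup>2"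
      using a by (simp add: field_simps power2_eq_square)
  qed
  also have "\<dots> = a / 2 + 1 / (2 * a) * bexp p I (\<lambda>S. (Z S)\<^sup>2)"
    using fin by (simp only: bexp_add bexp_cmult bexp_const)
  also have "\<dots> \<le> a / 2 + 1 / (2 * a) * (\<Sum>x\<in>J. p x * (1 - p x))"
    using a VZ by (intro add_left_mono mult_left_mono) auto
  finally show ?thesis using a unfolding cov by (simp add: field_simps)
qed

text \<open>
  The function \<open>\<phi>\<close> is the mean cluster size, scaled to take values in \<open>[0, 1]\<close>. If there are two clusters of size at
  least \<open>s\<close>, then each of the at least \<open>s\<^sup>2\<close> edges of color \<open>j\<close> between them would increase \<open>\<phi>\<close> by at least
  \<open>2 * s\<^sup>2 / n\<^sup>2\<close>, so the total influence of the edges of color \<open>j\<close> is at least of order \<open>s ^ 4 / n\<^sup>2\<close>. This is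
  compared with the upper bound in \<open>bexp_covariance_sum\<close>.
\<close>

lemma two_large_clusters_bound:
  fixes p :: "'c \<times> 'v set \<Rightarrow> real"
  assumes V: "finite V" "V \<noteq> {}" and K: "finite K" and C: "C \<subseteq> K" "j \<in> C"
    and p: "\<And>c e. p (c, e) = \<pi> c" and \<pi>: "\<And>c. c \<in> K \<Longrightarrow> \<pi> c \<in> {0..1}"
    and q: "\<pi> j = q" "0 < q" and s: "0 \<le> s"
  shows "2 * q * (1 - q) * s ^ 4 * bexp p (K \<times> nsets V 2) (\<lambda>S. of_bool (two_large_clusters V s (S `` C)))
    \<le> real (card V) ^ 3 * sqrt q"
proof -
  define n where "n = real (card V)"
  have n: "n > 0" using V by (simp add: n_def card_gt_0_iff)
  let ?I = "K \<times> nsets V 2"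
  define J where "J = {j} \<times> nsets V 2"
  have fin: "finite ?I" using K V by (auto intro: finite_imp_finite_nsets)
  have J: "J \<subseteq> ?I" "finite J" using C V by (auto simp: J_def intro: finite_imp_finite_nsets)
  have p01: "p x \<in> {0..1}" if "x \<in> ?I" for x using that p \<pi> by auto
  have q1: "q \<le> 1" using \<pi> C q by auto
  define \<phi> where "\<phi> = (\<lambda>E. (\<Sum>v\<in>V. real (card (cluster E v))) / n\<^sup>2)"
  define f where "f = (\<lambda>S :: ('c \<times> 'v set) set. \<phi> (S `` C))"
  have \<phi>: "0 \<le> \<phi> E" "\<phi> E \<le> 1" if "E \<subseteq> nsets V 2" for E
  proof -
    have "(\<Sum>v\<in>V. real (card (cluster E v))) \<le> (\<Sum>v\<in>V. n)"
      using that V by (intro sum_mono) (auto simp: n_def finite_cluster)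
    also have "\<dots> = n\<^sup>2" by (simp add: n_def power2_eq_square)
    finally show "\<phi> E \<le> 1" using n by (simp add: \<phi>_def)
    show "0 \<le> \<phi> E" by (simp add: \<phi>_def sum_nonneg)
  qed
  have \<phi>_mono: "\<phi> E \<le> \<phi> F" if "E \<subseteq> F" "F \<subseteq> nsets V 2" for E F
    unfolding \<phi>_def
  proof (intro divide_right_mono sum_mono of_nat_mono card_mono)
    show "finite (cluster F v)" if "v \<in> V" for v using V that \<open>F \<subseteq> nsets V 2\<close> by (intro finite_cluster)
    show "cluster E v \<subseteq> cluster F v" for v using \<open>E \<subseteq> F\<close> by (rule cluster_mono)
  qed simp
  have incr: "2 * s ^ 4 / n\<^sup>2 * of_bool (two_large_clusters V s (S `` C))
      \<le> (\<Sum>x\<in>J. f (insert x S) - f (S - {x}))" if S: "S \<subseteq> ?I" for S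
  proof -
    have mono: "f S' \<le> f T" if "S' \<subseteq> T" "T \<subseteq> ?I" for S' T
      unfolding f_def using that by (intro \<phi>_mono nsets_Image) auto
    have nonneg: "0 \<le> f (insert x S) - f (S - {x})" if "x \<in> J" for x
      using mono[of "S - {x}" "insert x S"] S J that by auto
    show ?thesis
    proof (cases "two_large_clusters V s (S `` C)")
      case False
      then show ?thesis using nonneg by (simp add: sum_nonneg)
    next
      case True
      define E where "E = S `` C"
      have E: "E \<subseteq> nsets V 2" unfolding E_def using S by (rule nsets_Image)
      obtain u w where uw: "u \<in> V" "w \<in> V" "s \<le> card (cluster E u)" "s \<le> card (cluster E w)"
        "w \<notin> cluster E u"
        using True unfolding two_large_clusters_def E_def by auto
      let ?P = "cluster E u" and ?Q = "cluster E w"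
      have sub: "?P \<subseteq> V" "?Q \<subseteq> V" using cluster_subset E uw by metis+
      have fin': "finite ?P" "finite ?Q" using sub V finite_subset by auto
      have disj: "?P \<inter> ?Q = {}"
        using uw(5) cluster_eq cluster_sym by (metis disjoint_iff cluster_refl)
      have s2: "s\<^sup>2 \<le> real (card ?P) * real (card ?Q)"
        unfolding power2_eq_square using uw s by (intro mult_mono) auto
      define g where "g = (\<lambda>(a, b). (j, {a, b :: 'v}))"
      have inj: "inj_on g (?P \<times> ?Q)"
        using disj by (auto simp: inj_on_def g_def doubleton_eq_iff)
      have gJ: "g ` (?P \<times> ?Q) \<subseteq> J"
        using sub disj by (auto simp: g_def J_def)
      have each: "2 * s\<^sup>2 / n\<^sup>2 \<le> f (insert (g z) S) - f (S - {g z})" if z: "z \<in> ?P \<times> ?Q" for z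
      proof -
        obtain a b where ab: "z = (a, b)" "a \<in> ?P" "b \<in> ?Q" using z by auto
        have cl: "cluster E a = ?P" "cluster E b = ?Q" using ab cluster_eq by metis+
        have *: "a \<in> V" "b \<in> V" "b \<notin> cluster E a" using ab sub disj cl by auto
        have "insert (g z) S `` C = insert {a, b} E"
          using C by (auto simp: E_def g_def ab)
        then have "f (insert (g z) S) = \<phi> (insert {a, b} E)" by (simp add: f_def)
        moreover have "2 * s\<^sup>2 \<le> (\<Sum>v\<in>V. real (card (cluster (insert {a, b} E) v)))
             - (\<Sum>v\<in>V. real (card (cluster E v)))"
          using susceptibility_increment[OF V(1) E *] s2 by (simp add: cl mult_ac)
        then have "2 * s\<^sup>2 / n\<^sup>2 \<le> \<phi> (insert {a, b} E) - \<phi> E"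
          unfolding \<phi>_def diff_divide_distrib[symmetric] by (intro divide_right_mono) auto
        moreover have "f (S - {g z}) \<le> \<phi> E"
          using mono[of "S - {g z}" S] S by (auto simp: f_def E_def)
        ultimately show ?thesis by simp
      qed
      have "2 * s ^ 4 / n\<^sup>2 = s\<^sup>2 * (2 * s\<^sup>2 / n\<^sup>2)" by (simp add: power2_eq_square power4_eq_xxxx)
      also have "\<dots> \<le> (real (card ?P) * real (card ?Q)) * (2 * s\<^sup>2 / n\<^sup>2)"
        using s2 by (intro mult_right_mono) auto
      also have "\<dots> = (\<Sum>z\<in>?P \<times> ?Q. 2 * s\<^sup>2 / n\<^sup>2)" by (simp add: card_cartesian_product)
      also have "\<dots> \<le> (\<Sum>z\<in>?P \<times> ?Q. f (insert (g z) S) - f (S - {g z}))"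
        using each by (intro sum_mono) auto
      also have "\<dots> = (\<Sum>x\<in>g ` (?P \<times> ?Q). f (insert x S) - f (S - {x}))"
        by (simp add: sum.reindex[OF inj])
      also have "\<dots> \<le> (\<Sum>x\<in>J. f (insert x S) - f (S - {x}))"
        using gJ J nonneg by (intro sum_mono2) auto
      finally show ?thesis using True by simp
    qed
  qed
  have pJ: "p x = q" if "x \<in> J" for x using that p q by (auto simp: J_def)
  have "q * (1 - q) * (2 * s ^ 4 / n\<^sup>2) * bexp p ?I (\<lambda>S. of_bool (two_large_clusters V s (S `` C)))
    = q * (1 - q) * bexp p ?I (\<lambda>S. 2 * s ^ 4 / n\<^sup>2 * of_bool (two_large_clusters V s (S `` C)))"
    by (simp only: bexp_cmult mult.assoc)
  also have "\<dots> \<le> q * (1 - q) * bexp p ?I (\<lambda>S. \<Sum>x\<in>J. f (insert x S) - f (S - {x}))"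
    using q q1 incr by (intro mult_left_mono bexp_mono p01) auto
  also have "\<dots> = (\<Sum>x\<in>J. p x * (1 - p x) * bexp p ?I (\<lambda>S. f (insert x S) - f (S - {x})))"
    unfolding bexp_sum sum_distrib_left by (intro sum.cong refl) (simp add: pJ)
  \<comment> \<open>The weight \<open>n * sqrt q\<close> balances the two terms, because the variance is at most \<open>n\<^sup>2 * q\<close>.\<close>
  also have "\<dots> \<le> (n * sqrt q + (\<Sum>x\<in>J. p x * (1 - p x)) / (n * sqrt q)) / 2"
  proof (rule bexp_covariance_sum[OF fin p01 J(1)])
    show "\<bar>f S\<bar> \<le> 1" if "S \<subseteq> ?I" for S
      using \<phi>[OF nsets_Image[OF that]] by (simp add: f_def)
    show "0 < n * sqrt q" using n q by simp
  qed
  also have "\<dots> \<le> n * sqrt q"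
  proof -
    have "(\<Sum>x\<in>J. p x * (1 - p x)) \<le> (\<Sum>x\<in>J. q)"
      using q q1 by (intro sum_mono) (simp add: pJ mult_left_le)
    also have "\<dots> = real (card V choose 2) * q" by (simp add: J_def card_cartesian_product)
    also have "\<dots> \<le> n\<^sup>2 * q"
    proof (intro mult_right_mono)
      have "real (card V choose 2) \<le> real (card V ^ 2)"
        using binomial_fact_pow[of "card V" 2] by (intro of_nat_mono) simp
      then show "real (card V choose 2) \<le> n\<^sup>2" by (simp add: n_def)
    qed (use q in auto)
    also have "\<dots> = (n * sqrt q) * (n * sqrt q)"
      using q by (simp add: power2_eq_square)
    finally have "(\<Sum>x\<in>J. p x * (1 - p x)) / (n * sqrt q) \<le> n * sqrt q"
      using n q by (simp add: divide_le_eq)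
    then show ?thesis by simp
  qed
  finally have "q * (1 - q) * (2 * s ^ 4 / n\<^sup>2) * bexp p ?I (\<lambda>S. of_bool (two_large_clusters V s (S `` C)))
     \<le> n * sqrt q" .
  then have "n\<^sup>2 * (q * (1 - q) * (2 * s ^ 4 / n\<^sup>2) * bexp p ?I (\<lambda>S. of_bool (two_large_clusters V s (S `` C))))
     \<le> n\<^sup>2 * (n * sqrt q)" using n by (intro mult_left_mono) auto
  then show ?thesis
    using n unfolding n_def[symmetric]
    by (simp add: power2_eq_square power3_eq_cube)
qed

section \<open>Vertices whose clusters are large for every deleted color\<close>

definition jointly_large :: "'v set \<Rightarrow> 'i set \<Rightarrow> ('i \<Rightarrow> 'c set) \<Rightarrow> real \<Rightarrow> ('c \<times> 'v set) set \<Rightarrow> 'v set" where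
  "jointly_large V J C s S = {v\<in>V. \<forall>i\<in>J. s \<le> card (cluster (S `` C i) v)}"

lemma bexp_chebyshev:
  assumes "finite I" "\<And>x. x \<in> I \<Longrightarrow> p x \<in> {0..1}" "0 \<le> h"
  shows "h\<^sup>2 * bexp p I (\<lambda>S. of_bool (f S \<le> bexp p I f - h))
    \<le> (\<Sum>x\<in>I. p x * (1 - p x) * bexp p I (\<lambda>S. (f (insert x S) - f (S - {x}))\<^sup>2))"
proof -
  define m where "m = bexp p I f"
  have "h\<^sup>2 * bexp p I (\<lambda>S. of_bool (f S \<le> m - h)) = bexp p I (\<lambda>S. h\<^sup>2 * of_bool (f S \<le> m - h))"
    by (simp add: bexp_cmult)
  also have "\<dots> \<le> bexp p I (\<lambda>S. (f S)\<^sup>2 - (2 * m) * f S + m\<^sup>2)"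
  proof (rule bexp_mono[OF assms(2)])
    fix S
    have "h\<^sup>2 \<le> (m - f S)\<^sup>2" if "f S \<le> m - h" using that assms(3) by (intro power_mono) auto
    then have "h\<^sup>2 * of_bool (f S \<le> m - h) \<le> (m - f S)\<^sup>2" by auto
    then show "h\<^sup>2 * of_bool (f S \<le> m - h) \<le> (f S)\<^sup>2 - (2 * m) * f S + m\<^sup>2"
      by (simp add: power2_diff algebra_simps)
  qed
  also have "\<dots> = bexp p I (\<lambda>S. (f S)\<^sup>2) - m\<^sup>2"
    using assms(1) by (simp only: bexp_add bexp_diff bexp_cmult bexp_const)
      (simp add: m_def power2_eq_square)
  also have "\<dots> \<le> (\<Sum>x\<in>I. p x * (1 - p x) * bexp p I (\<lambda>S. (f (insert x S) - f (S - {x}))\<^sup>2))"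
    unfolding m_def by (rule efron_stein[OF assms(1,2)])
  finally show ?thesis by (simp add: m_def)
qed

text \<open>
  Inserting an edge can push only those vertices over the threshold \<open>s\<close> whose old cluster contains an endpoint of the edge
  and has size less than \<open>s\<close>. For each \<open>i\<close>, they lie in two clusters of size less than \<open>s\<close>.
\<close>

lemma jointly_large_increment:
  assumes V: "finite V" and J: "finite J" and s: "0 \<le> s"
    and S: "S \<subseteq> K \<times> nsets V 2" and x: "x \<in> K \<times> nsets V 2"
  shows "(real (card (jointly_large V J C s (insert x S))) - real (card (jointly_large V J C s (S - {x}))))\<^sup>2
    \<le> (2 * real (card J) * s)\<^sup>2"
proof -
  obtain c u w where x_eq: "x = (c, {u, w})" and uw: "u \<in> V" "w \<in> V" "u \<noteq> w"
    using x by (auto simp: nsets_2_eq)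
  define T where "T = S - {x}"
  have ins: "insert x S = insert x T" by (auto simp: T_def)
  have T: "T \<subseteq> K \<times> nsets V 2" "insert x T \<subseteq> K \<times> nsets V 2" using S x by (auto simp: T_def)
  let ?Y = "jointly_large V J C s"
  let ?cl = "\<lambda>i v. cluster (T `` C i) v"
  let ?B = "\<lambda>i z. if real (card (?cl i z)) < s then ?cl i z else {}"
  have finY: "finite (?Y R)" for R using V by (simp add: jointly_large_def)
  have mono: "?Y T \<subseteq> ?Y (insert x T)"
  proof
    fix v assume v: "v \<in> ?Y T"
    have "s \<le> card (cluster (insert x T `` C i) v)" if "i \<in> J" for i
    proof -
      have "card (?cl i v) \<le> card (cluster (insert x T `` C i) v)"
        using v V nsets_Image[OF T(2)]
        by (intro card_mono finite_cluster(1)[OF V] cluster_mono) (auto simp: jointly_large_def)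
      moreover have "s \<le> card (?cl i v)" using v that by (auto simp: jointly_large_def)
      ultimately show ?thesis by linarith
    qed
    then show "v \<in> ?Y (insert x T)" using v by (auto simp: jointly_large_def)
  qed
  have new: "?Y (insert x T) - ?Y T \<subseteq> (\<Union>i\<in>J. ?B i u \<union> ?B i w)"
  proof
    fix v assume v: "v \<in> ?Y (insert x T) - ?Y T"
    then obtain i where i: "i \<in> J" "real (card (?cl i v)) < s"
      by (auto simp: jointly_large_def not_le)
    have ge: "s \<le> card (cluster (insert x T `` C i) v)" using v i by (auto simp: jointly_large_def)
    have "u \<in> ?cl i v \<or> w \<in> ?cl i v"
    proof (rule ccontr)
      assume "\<not> ?thesis"
      then have "cluster (insert {u, w} (T `` C i)) v = ?cl i v" by (intro cluster_insert_far) auto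
      moreover have "insert x T `` C i = T `` C i \<or> insert x T `` C i = insert {u, w} (T `` C i)"
        by (auto simp: x_eq)
      ultimately show False using ge i by auto
    qed
    then show "v \<in> (\<Union>i\<in>J. ?B i u \<union> ?B i w)"
    proof
      assume "u \<in> ?cl i v"
      then have "?cl i u = ?cl i v" by (rule cluster_eq)
      then show ?thesis using i by (intro UN_I[of i]) auto
    next
      assume "w \<in> ?cl i v"
      then have "?cl i w = ?cl i v" by (rule cluster_eq)
      then show ?thesis using i by (intro UN_I[of i]) auto
    qed
  qed
  have finB: "finite (?B i z)" if "z \<in> V" for i z
    using finite_cluster(1)[OF V nsets_Image[OF T(1)] that] by auto
  have "real (card (?Y (insert x T) - ?Y T)) \<le> real (card (\<Union>i\<in>J. ?B i u \<union> ?B i w))"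
    using new J finB uw by (intro of_nat_mono card_mono) auto
  also have "\<dots> \<le> real (\<Sum>i\<in>J. card (?B i u \<union> ?B i w))"
    using J by (intro of_nat_mono card_UN_le)
  also have "\<dots> \<le> (\<Sum>i\<in>J. 2 * s)"
    unfolding of_nat_sum
  proof (intro sum_mono)
    fix i
    have "real (card (?B i u \<union> ?B i w)) \<le> real (card (?B i u)) + real (card (?B i w))"
      unfolding of_nat_add[symmetric] by (intro of_nat_mono card_Un_le)
    also have "\<dots> \<le> s + s" using s by (intro add_mono) auto
    finally show "real (card (?B i u \<union> ?B i w)) \<le> 2 * s" by simp
  qed
  finally have "real (card (?Y (insert x T) - ?Y T)) \<le> 2 * real (card J) * s" by simp
  moreover have "real (card (?Y (insert x T))) = real (card (?Y T)) + real (card (?Y (insert x T) - ?Y T))"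
    using card_Diff_subset[OF finY mono] card_mono[OF finY mono] by simp
  ultimately show ?thesis unfolding ins T_def[symmetric] by (intro power_mono) auto
qed

section \<open>Extinction of the branching process without one color\<close>

text \<open>
  The offspring counts seen from the child \<open>a\<close> of the root. The restriction makes the result a point of
  the same product space.
\<close>

definition subtree_offspring :: "nat \<Rightarrow> nat \<times> nat \<Rightarrow> (node \<times> nat \<Rightarrow> nat) \<Rightarrow> (node \<times> nat \<Rightarrow> nat)" where
  "subtree_offspring k a X = (\<lambda>n\<in>UNIV \<times> {1..k}. X (a # fst n, snd n))"

text \<open>
  The tree has a vertex of generation \<open>m\<close> that is reached from the root by edges with colors in \<open>C\<close>. The recursion
  at the root, rather than at the last generation, exhibits the independent subtrees.
\<close>

primrec survives :: "nat \<Rightarrow> nat set \<Rightarrow> nat \<Rightarrow> (node \<times> nat \<Rightarrow> nat) \<Rightarrow> bool" where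
  "survives k C 0 X \<longleftrightarrow> True"
| "survives k C (Suc m) X \<longleftrightarrow>
     (\<exists>c\<in>C. \<exists>j<X ([], c). survives k C m (subtree_offspring k (c, j) X))"

lemma tree_nodes_Cons:
  assumes "w \<in> tree_nodes k X" "w = (c, j) # v"
  shows "c \<in> {1..k} \<and> j < X ([], c) \<and> v \<in> tree_nodes k (subtree_offspring k (c, j) X)"
  using assms
proof (induction arbitrary: v rule: tree_nodes.induct)
  case root
  then show ?case by simp
next
  case (child w i l)
  show ?case
  proof (cases w)
    case Nil
    then show ?thesis using child by (auto intro: tree_nodes.root)
  next
    case (Cons a w')
    then have a: "a = (c, j)" "v = w' @ [(i, l)]" using child.prems by auto
    have IH: "c \<in> {1..k} \<and> j < X ([], c) \<and> w' \<in> tree_nodes k (subtree_offspring k (c, j) X)"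
      using child.IH Cons a by simp
    moreover have "l < subtree_offspring k (c, j) X (w', i)"
      using child.hyps Cons a by (simp add: subtree_offspring_def)
    ultimately show ?thesis using child.hyps unfolding a by (auto intro: tree_nodes.child)
  qed
qed

lemma survives_if_node:
  assumes "v \<in> tree_nodes k X" "fst ` set v \<subseteq> C" "length v = m"
  shows "survives k C m X"
  using assms
proof (induction m arbitrary: v X)
  case 0 then show ?case by simp
next
  case (Suc m)
  then obtain c j v' where v: "v = (c, j) # v'" by (cases v) auto
  then have "c \<in> {1..k} \<and> j < X ([], c) \<and> v' \<in> tree_nodes k (subtree_offspring k (c, j) X)"
    using Suc.prems tree_nodes_Cons by blast
  moreover have "c \<in> C" "fst ` set v' \<subseteq> C" "length v' = m" using Suc.prems v by auto
  ultimately have "c \<in> C" "j < X ([], c)" "survives k C m (subtree_offspring k (c, j) X)"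
    using Suc.IH by blast+
  then show ?case unfolding survives.simps by blast
qed

lemma tree_nodes_snocD:
  assumes "v @ [(c, j)] \<in> tree_nodes k X"
  shows "v \<in> tree_nodes k X" "c \<in> {1..k}" "j < X (v, c)"
  using assms by (auto elim: tree_nodes.cases)

lemma tree_nodes_prefix: "v @ w \<in> tree_nodes k X \<Longrightarrow> v \<in> tree_nodes k X"
proof (induction w rule: rev_induct)
  case (snoc x w)
  then show ?case using tree_nodes_snocD(1)[of "v @ w" "fst x" "snd x"] by simp
qed simp

text \<open>
  The tree is locally finite, so each generation is finite; since the vertices in question are closed under
  prefixes, an empty generation would leave only finitely many of them.
\<close>

lemma survives_if_infinite:
  assumes "infinite {v \<in> tree_nodes k X. fst ` set v \<subseteq> C}" "finite C"
  shows "survives k C m X"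
proof (rule ccontr)
  assume contra: "\<not> survives k C m X"
  define T where "T = {v \<in> tree_nodes k X. fst ` set v \<subseteq> C}"
  have level: "finite {v \<in> T. length v = l}" for l
  proof (induction l)
    case 0
    have "{v \<in> T. length v = 0} \<subseteq> {[]}" by auto
    then show ?case using finite_subset by blast
  next
    case (Suc l)
    have "{v \<in> T. length v = Suc l} \<subseteq> (\<lambda>(v, c, j). v @ [(c, j)]) `
       (SIGMA v:{v \<in> T. length v = l}. SIGMA c:C. {..<X (v, c)})"
    proof
      fix w assume w: "w \<in> {v \<in> T. length v = Suc l}"
      then obtain v x where wv: "w = v @ [x]" by (cases w rule: rev_cases) auto
      obtain c j where x: "x = (c, j)" by (cases x)
      have "v @ [(c, j)] \<in> tree_nodes k X" using w wv x by (simp add: T_def)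
      note tree_nodes_snocD[OF this]
      then show "w \<in> (\<lambda>(v, c, j). v @ [(c, j)]) `
          (SIGMA v:{v \<in> T. length v = l}. SIGMA c:C. {..<X (v, c)})"
        using w wv x by (intro image_eqI[of _ _ "(v, c, j)"]) (auto simp: T_def)
    qed
    then show ?case using Suc assms(2) by (elim finite_subset) (intro finite_imageI finite_SigmaI; auto)
  qed
  have "T \<subseteq> (\<Union>l<m. {v \<in> T. length v = l})"
  proof
    fix v assume v: "v \<in> T"
    have "length v < m"
    proof (rule ccontr)
      assume "\<not> length v < m"
      then have "length (take m v) = m" by simp
      moreover have "take m v \<in> tree_nodes k X"
        using v tree_nodes_prefix[of "take m v" "drop m v" k X] by (simp add: T_def)
      moreover have "fst ` set (take m v) \<subseteq> C" using v set_take_subset[of m v] by (auto simp: T_def)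
      ultimately show False using survives_if_node contra by blast
    qed
    then show "v \<in> (\<Union>l<m. {v \<in> T. length v = l})" using v by auto
  qed
  then have "finite T" using level finite_subset by blast
  then show False using assms(1) by (simp add: T_def)
qed

text \<open>
  Either the root is joined to infinity without color \<open>i\<close>, and the infinite path stays in the part \<open>T\<close>
  of the tree that the root reaches without color \<open>i\<close>; or all friends of the root lie in \<open>T\<close>. In both cases \<open>T\<close> is infinite.
\<close>

lemma survives_if_infinite_friends:
  assumes "infinite (root_friends k (ecbp_tree k X))" "i \<in> {1..k}"
  shows "survives k ({1..k} - {i}) m X"
proof (rule survives_if_infinite)
  define C where "C = {1..k} - {i}"
  define T where "T = {v \<in> tree_nodes k X. fst ` set v \<subseteq> C}"
  have root: "[] \<in> T" by (simp add: T_def tree_nodes.root)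
  have step: "y \<in> T" if x: "x \<in> T" and e: "{x, y} \<in> edges_of_colors (ecbp_tree k X) C" for x y
  proof -
    obtain c v j where c: "c \<in> C" "{x, y} = {v, v @ [(c, j)]}" "v \<in> tree_nodes k X"
      "v @ [(c, j)] \<in> tree_nodes k X"
      using e by (auto simp: edges_of_colors_def ecbp_tree_def)
    then consider "x = v" "y = v @ [(c, j)]" | "y = v" "x = v @ [(c, j)]"
      by (auto simp: doubleton_eq_iff)
    then show ?thesis using c x by cases (auto simp: T_def)
  qed
  have "infinite T"
  proof (cases "avoiding_connected_infinity k (ecbp_tree k X) i []")
    case True
    then obtain p where p: "p 0 = []" "inj p"
      "\<And>m. {p m, p (Suc m)} \<in> edges_of_colors (ecbp_tree k X) C"
      unfolding avoiding_connected_infinity_def C_def by blast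
    have "p m \<in> T" for m by (induction m) (use p root step in auto)
    then have "range p \<subseteq> T" by auto
    then show ?thesis using p(2) finite_subset range_inj_infinite by blast
  next
    case False
    have "root_friends k (ecbp_tree k X) \<subseteq> T"
    proof
      fix v assume "v \<in> root_friends k (ecbp_tree k X)"
      then have "([], v) \<in> {(x, y). {x, y} \<in> edges_of_colors (ecbp_tree k X) C}\<^sup>*"
        using False assms(2)
        by (auto simp: root_friends_def avoiding_friends_def avoiding_connected_def connected_by_def C_def)
      then show "v \<in> T" by (induction rule: rtrancl_induct) (use root step in auto)
    qed
    then show ?thesis using assms(1) finite_subset by blast
  qed
  then show "infinite {v \<in> tree_nodes k X. fst ` set v \<subseteq> {1..k} - {i}}" by (simp add: T_def C_def)
qed simp

locale colored_branching =
  fixes k :: nat and lam :: "nat \<Rightarrow> real" and C :: "nat set"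
  assumes pos: "\<And>i. i \<in> {1..k} \<Longrightarrow> lam i > 0" and C: "C \<subseteq> {1..k}"
begin

abbreviation "offspring_index \<equiv> (UNIV :: node set) \<times> {1..k}"

abbreviation "offspring_law \<equiv> (\<lambda>n :: node \<times> nat. measure_pmf (poisson_pmf (lam (snd n))))"

abbreviation "\<Omega> \<equiv> PiM offspring_index offspring_law"

lemma offspring_space_eq: "offspring_space k lam = \<Omega>"
  by (simp add: offspring_space_def case_prod_unfold)

sublocale prob_space \<Omega>
  by (intro prob_space_PiM measure_pmf.prob_space_axioms)

lemma coordinates_indep: "indep_vars offspring_law (\<lambda>n \<omega>. \<omega> n) offspring_index"
proof (cases "offspring_index = {}")
  case True
  then have "n \<notin> offspring_index" for n by blast
  then show ?thesis unfolding indep_vars_def indep_sets_def by blast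
next
  case False
  have "distr \<Omega> \<Omega> (\<lambda>x. \<lambda>n\<in>offspring_index. x n) = distr \<Omega> \<Omega> (\<lambda>x. x)"
    by (intro distr_cong) (auto simp: space_PiM)
  also have "\<dots> = \<Omega>" by (rule distr_id)
  also have "\<dots> = PiM offspring_index (\<lambda>n. distr \<Omega> (offspring_law n) (\<lambda>\<omega>. \<omega> n))"
    by (intro PiM_cong refl distr_PiM_component[symmetric] measure_pmf.prob_space_axioms)
  finally show ?thesis
    using False by (subst indep_vars_iff_distr_eq_PiM') (auto intro: measurable_component_singleton)
qed

lemma subtree_measurable:
  assumes "\<And>v d. d \<in> {1..k} \<Longrightarrow> (a # v, d) \<in> I"
  shows "subtree_offspring k a \<in> measurable (PiM I offspring_law) \<Omega>"
proof -
  have "(\<lambda>X. X (a # fst n, snd n)) \<in> measurable (PiM I offspring_law) (offspring_law n)"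
    if "n \<in> offspring_index" for n
    using measurable_component_singleton[of "(a # fst n, snd n)" I offspring_law] assms that by auto
  then show ?thesis
    unfolding subtree_offspring_def by (intro measurable_restrict) auto
qed

lemma subtree_law: "distr \<Omega> \<Omega> (subtree_offspring k a) = \<Omega>"
proof -
  have "distr \<Omega> (PiM offspring_index (\<lambda>n. offspring_law (a # fst n, snd n)))
      (\<lambda>\<omega>. \<lambda>n\<in>offspring_index. \<omega> (a # fst n, snd n))
     = PiM offspring_index (\<lambda>n. offspring_law (a # fst n, snd n))"
    by (intro distr_PiM_reindex measure_pmf.prob_space_axioms) (auto simp: inj_on_def)
  then show ?thesis by (simp add: subtree_offspring_def[abs_def])
qed

lemma survives_measurable: "{X \<in> space \<Omega>. survives k C m X} \<in> sets \<Omega>"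
proof (induction m)
  case 0
  then show ?case by simp
next
  case (Suc m)
  have fin: "finite C" using C finite_subset by auto
  have sub: "{X \<in> space \<Omega>. survives k C m (subtree_offspring k (c, j) X)} \<in> sets \<Omega>" for c j
  proof -
    have "subtree_offspring k (c, j) \<in> measurable \<Omega> \<Omega>" by (rule subtree_measurable) auto
    from measurable_sets[OF this Suc] measurable_space[OF this]
    show ?thesis by (simp add: vimage_def Int_def conj_commute cong: conj_cong)
  qed
  have root: "{X \<in> space \<Omega>. j < X ([], c)} \<in> sets \<Omega>" if "c \<in> C" for c j
  proof -
    have "(\<lambda>X. X ([], c)) \<in> measurable \<Omega> (count_space UNIV)"
      using measurable_component_singleton[of "([], c)" offspring_index offspring_law] that C
      by auto
    from measurable_sets[OF this, of "{j<..}"] show ?thesis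
      by (simp add: vimage_def Int_def conj_commute)
  qed
  have "{X \<in> space \<Omega>. survives k C (Suc m) X} = (\<Union>c\<in>C. \<Union>j. {X \<in> space \<Omega>. j < X ([], c)} \<inter>
      {X \<in> space \<Omega>. survives k C m (subtree_offspring k (c, j) X)})"
    by auto
  also have "\<dots> \<in> sets \<Omega>"
    using sub root fin by (intro sets.finite_UN sets.countable_UN' sets.Int) auto
  finally show ?case .
qed

definition dies :: "nat \<Rightarrow> real" where
  "dies m = prob {X \<in> space \<Omega>. \<not> survives k C m X}"

lemma dies_measurable: "{X \<in> space \<Omega>. \<not> survives k C m X} \<in> sets \<Omega>"
proof -
  have "{X \<in> space \<Omega>. \<not> survives k C m X} = space \<Omega> - {X \<in> space \<Omega>. survives k C m X}" by auto
  then show ?thesis using survives_measurable[of m] by simp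
qed

text \<open>
  Disjoint blocks of coordinates: the number of children of color \<open>c\<close> of the root, and all the counts in the
  subtree of its child \<open>a\<close>.
\<close>

definition block :: "nat + nat \<times> nat \<Rightarrow> (node \<times> nat) set" where
  "block b = (case b of Inl c \<Rightarrow> {([], c)} | Inr a \<Rightarrow> {(a # v, d) | v d. d \<in> {1..k}})"

text \<open>
  The numbers of children of the root and the subtrees of these children depend on disjoint blocks of
  coordinates, and each subtree has the law of the whole tree.
\<close>

lemma prob_children_die:
  assumes "C \<noteq> {}"
  shows "prob {X \<in> space \<Omega>. (\<forall>c\<in>C. X ([], c) = x c) \<and>
      (\<forall>c\<in>C. \<forall>j<x c. \<not> survives k C m (subtree_offspring k (c, j) X))}
    = (\<Prod>c\<in>C. pmf (poisson_pmf (lam c)) (x c) * dies m ^ x c)"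
proof -
  have fin: "finite C" using C finite_subset by auto
  define L where "L = Inl ` C \<union> Inr ` (SIGMA c:C. {..<x c})"
  have L: "finite L" "L \<noteq> {}" using fin assms by (auto simp: L_def)
  have blocks: "indep_vars (\<lambda>b. PiM (block b) offspring_law) (\<lambda>b \<omega>. restrict (\<lambda>n. \<omega> n) (block b)) L"
    by (intro indep_vars_restrict[OF coordinates_indep])
      (use C in \<open>auto simp: L_def block_def disjoint_family_on_def split: sum.splits\<close>)
  define A where "A = (\<lambda>b. case b of
      Inl c \<Rightarrow> {\<omega> \<in> space (PiM (block b) offspring_law). \<omega> ([], c) = x c}
    | Inr a \<Rightarrow> {\<omega> \<in> space (PiM (block b) offspring_law). \<not> survives k C m (subtree_offspring k a \<omega>)})"
  have A: "A b \<in> sets (PiM (block b) offspring_law)" for b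
  proof (cases b)
    case (Inl c)
    have "(\<lambda>X. X ([], c)) \<in> measurable (PiM (block b) offspring_law) (count_space UNIV)"
      using measurable_component_singleton[of "([], c)" "block b" offspring_law]
      by (auto simp: Inl block_def)
    from measurable_sets[OF this, of "{x c}"] show ?thesis
      by (simp add: A_def Inl vimage_def Int_def conj_commute)
  next
    case (Inr a)
    have "subtree_offspring k a \<in> measurable (PiM (block b) offspring_law) \<Omega>"
      by (rule subtree_measurable) (auto simp: Inr block_def)
    from measurable_sets[OF this dies_measurable[of m]] measurable_space[OF this]
    show ?thesis by (simp add: A_def Inr vimage_def Int_def conj_commute cong: conj_cong)
  qed
  define E where "E = (\<lambda>b. (\<lambda>\<omega>. restrict (\<lambda>n. \<omega> n) (block b)) -` A b \<inter> space \<Omega>)"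
  have E_Inl: "E (Inl c) = {X \<in> space \<Omega>. X ([], c) = x c}" for c
    by (auto simp: E_def A_def block_def space_PiM)
  have E_Inr: "E (Inr a) = {X \<in> space \<Omega>. \<not> survives k C m (subtree_offspring k a X)}" for a
  proof -
    have "subtree_offspring k a (restrict X (block (Inr a))) = subtree_offspring k a X" for X
      by (auto simp: subtree_offspring_def block_def fun_eq_iff)
    then show ?thesis by (auto simp: E_def A_def space_PiM)
  qed
  have P_Inl: "prob (E (Inl c)) = pmf (poisson_pmf (lam c)) (x c)" if "c \<in> C" for c
  proof -
    have "distr \<Omega> (offspring_law ([], c)) (\<lambda>\<omega>. \<omega> ([], c)) = offspring_law ([], c)"
      using that C by (intro distr_PiM_component measure_pmf.prob_space_axioms) auto
    then have "measure (distr \<Omega> (offspring_law ([], c)) (\<lambda>\<omega>. \<omega> ([], c))) {x c} = pmf (poisson_pmf (lam c)) (x c)"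
      by (simp add: measure_pmf_single)
    moreover have "(\<lambda>\<omega>. \<omega> ([], c)) \<in> measurable \<Omega> (offspring_law ([], c))"
      using that C by (intro measurable_component_singleton) auto
    ultimately show ?thesis unfolding E_Inl
      by (simp add: measure_distr vimage_def Int_def conj_commute)
  qed
  have P_Inr: "prob (E (Inr a)) = dies m" for a
  proof -
    have m: "subtree_offspring k a \<in> measurable \<Omega> \<Omega>" by (rule subtree_measurable) auto
    have "dies m = measure (distr \<Omega> \<Omega> (subtree_offspring k a)) {X \<in> space \<Omega>. \<not> survives k C m X}"
      unfolding subtree_law dies_def ..
    also have "\<dots> = prob (subtree_offspring k a -` {X \<in> space \<Omega>. \<not> survives k C m X} \<inter> space \<Omega>)"
      by (rule measure_distr[OF m dies_measurable])
    also have "subtree_offspring k a -` {X \<in> space \<Omega>. \<not> survives k C m X} \<inter> space \<Omega> = E (Inr a)"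
      using measurable_space[OF m] by (auto simp: E_Inr)
    finally show ?thesis ..
  qed
  have "X \<in> (\<Inter>b\<in>L. E b) \<longleftrightarrow>
      (\<forall>c\<in>C. X \<in> E (Inl c)) \<and> (\<forall>c\<in>C. \<forall>j<x c. X \<in> E (Inr (c, j)))" for X
    unfolding L_def by blast
  then have "{X \<in> space \<Omega>. (\<forall>c\<in>C. X ([], c) = x c) \<and>
      (\<forall>c\<in>C. \<forall>j<x c. \<not> survives k C m (subtree_offspring k (c, j) X))} = (\<Inter>b\<in>L. E b)"
    using assms unfolding E_Inl E_Inr by blast
  also have "prob \<dots> = (\<Prod>b\<in>L. prob (E b))"
    unfolding E_def using L A by (intro indep_varsD_finite[OF blocks]) auto
  also have "\<dots> = (\<Prod>b\<in>Inl ` C. prob (E b)) * (\<Prod>b\<in>Inr ` (SIGMA c:C. {..<x c}). prob (E b))"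
    unfolding L_def using fin by (intro prod.union_disjoint) auto
  also have "(\<Prod>b\<in>Inl ` C. prob (E b)) = (\<Prod>c\<in>C. pmf (poisson_pmf (lam c)) (x c))"
    unfolding prod.reindex[OF inj_Inl] comp_def
    by (intro prod.cong refl P_Inl)
  also have "(\<Prod>b\<in>Inr ` (SIGMA c:C. {..<x c}). prob (E b)) = (\<Prod>z\<in>(SIGMA c:C. {..<x c}). dies m)"
    unfolding prod.reindex[OF inj_Inr] comp_def P_Inr ..
  also have "\<dots> = (\<Prod>c\<in>C. \<Prod>j<x c. dies m)"
    using fin by (subst prod.Sigma) (auto simp: case_prod_beta)
  finally show ?thesis by (simp add: prod.distrib)
qed

lemma poisson_pgf:
  assumes "c \<in> {1..k}"
  shows "(\<lambda>j. pmf (poisson_pmf (lam c)) j * z ^ j) sums exp (- (lam c * (1 - z)))"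
proof -
  have "(\<lambda>j. exp (- lam c) * ((lam c * z) ^ j /\<^sub>R fact j)) sums (exp (- lam c) * exp (lam c * z))"
    by (intro sums_mult exp_converges)
  moreover have "exp (- lam c) * exp (lam c * z) = exp (- (lam c * (1 - z)))"
    by (simp add: exp_add[symmetric] algebra_simps)
  moreover have "exp (- lam c) * ((lam c * z) ^ j /\<^sub>R fact j) = pmf (poisson_pmf (lam c)) j * z ^ j" for j
    using pos[OF assms] by (simp add: power_mult_distrib field_simps)
  ultimately show ?thesis by simp
qed

text \<open>
  The events that the root has exactly \<open>x c\<close> children of color \<open>c\<close>, all of which fail to survive for \<open>m\<close>
  generations, are disjoint for different \<open>x\<close>. Summing their probabilities over all \<open>x\<close> gives the product of the
  Poisson generating functions. Only finitely many \<open>x\<close> are summed at a time, and the bound \<open>B\<close> then tends to infinity.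
\<close>

lemma dies_Suc:
  assumes "C \<noteq> {}"
  shows "exp (- (\<Sum>c\<in>C. lam c) * (1 - dies m)) \<le> dies (Suc m)"
proof -
  have fin: "finite C" using C finite_subset by auto
  define g where "g = (\<lambda>c j. pmf (poisson_pmf (lam c)) j * dies m ^ j)"
  define E where "E = (\<lambda>x. {X \<in> space \<Omega>. (\<forall>c\<in>C. X ([], c) = x c) \<and>
      (\<forall>c\<in>C. \<forall>j<x c. \<not> survives k C m (subtree_offspring k (c, j) X))})"
  have trunc: "(\<Prod>c\<in>C. \<Sum>j<B. g c j) \<le> dies (Suc m)" for B
  proof -
    define F where "F = (PiE C (\<lambda>_. {..<B}))"
    have finF: "finite F" using fin by (auto simp: F_def intro: finite_PiE)
    have Em: "E x \<in> sets \<Omega>" for x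
    proof -
      have 1: "{X \<in> space \<Omega>. X ([], c) = x c} \<in> sets \<Omega>" if "c \<in> C" for c
      proof -
        have "(\<lambda>X. X ([], c)) \<in> measurable \<Omega> (count_space UNIV)"
          using measurable_component_singleton[of "([], c)" offspring_index offspring_law] that C
          by auto
        from measurable_sets[OF this, of "{x c}"] show ?thesis
          by (simp add: vimage_def Int_def conj_commute)
      qed
      have 2: "{X \<in> space \<Omega>. \<not> survives k C m (subtree_offspring k (c, j) X)} \<in> sets \<Omega>" for c j
      proof -
        have "subtree_offspring k (c, j) \<in> measurable \<Omega> \<Omega>" by (rule subtree_measurable) auto
        from measurable_sets[OF this dies_measurable[of m]] measurable_space[OF this]
        show ?thesis by (simp add: vimage_def Int_def conj_commute cong: conj_cong)
      qed
      show ?thesis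
        unfolding E_def using 1 2 fin
        by (intro sets.sets_Collect_conj sets.sets_Collect_finite_All' sets.sets_Collect_countable_All
              sets.sets_Collect_imp sets.sets_Collect_const) (use assms in auto)
    qed
    have disj: "disjoint_family_on E F"
    proof (unfold disjoint_family_on_def, intro ballI impI)
      fix x y assume xy: "x \<in> F" "y \<in> F" "x \<noteq> y"
      then obtain c where c: "x c \<noteq> y c" by blast
      then have "c \<in> C" using xy by (auto simp: F_def PiE_def extensional_def)
      then show "E x \<inter> E y = {}" using c by (auto simp: E_def)
    qed
    have "(\<Prod>c\<in>C. \<Sum>j<B. g c j) = (\<Sum>x\<in>F. \<Prod>c\<in>C. g c (x c))"
      unfolding F_def using fin by (intro prod_sum_PiE) auto
    also have "\<dots> = (\<Sum>x\<in>F. prob (E x))"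
      unfolding E_def g_def by (simp only: prob_children_die[OF assms])
    also have "\<dots> = prob (\<Union>x\<in>F. E x)"
      using finF Em disj by (intro finite_measure_finite_Union[symmetric]) auto
    also have "\<dots> \<le> dies (Suc m)"
      unfolding dies_def
    proof (intro finite_measure_mono dies_measurable)
      show "(\<Union>x\<in>F. E x) \<subseteq> {X \<in> space \<Omega>. \<not> survives k C (Suc m) X}"
        by (auto simp: E_def)
    qed
    finally show ?thesis .
  qed
  have "(\<lambda>B. \<Prod>c\<in>C. \<Sum>j<B. g c j) \<longlonglongrightarrow> (\<Prod>c\<in>C. exp (- (lam c * (1 - dies m))))"
    using poisson_pgf C unfolding g_def sums_def by (intro tendsto_prod) auto
  then have "(\<Prod>c\<in>C. exp (- (lam c * (1 - dies m)))) \<le> dies (Suc m)"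
    using trunc by (intro LIMSEQ_le_const2) auto
  then show ?thesis using fin by (simp add: exp_sum[symmetric] sum_distrib_right sum_negf)
qed

text \<open>
  In the critical case the mean generation size stays \<open>1\<close>, so the first moment does not suffice. The survival
  probabilities \<open>q\<close> satisfy \<open>q\<^sub>m\<^sub>+\<^sub>1 \<le> 1 - exp (- q\<^sub>m)\<close>, and \<open>1 - exp (- q) \<le> q - q ^ 3 / 3\<close> on \<open>[0, 1]\<close>; if they
  stayed above \<open>f\<close>, they would decrease by at least \<open>f ^ 3 / 3\<close> in each generation.
\<close>

lemma extinction:
  assumes "(\<Sum>c\<in>C. lam c) \<le> 1" "0 < f"
  shows "\<exists>m. 1 - dies m < f"
proof (rule ccontr)
  assume "\<not> ?thesis"
  then have q: "f \<le> 1 - dies m" for m by (simp add: not_less)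
  have C_ne: "C \<noteq> {}"
  proof
    assume "C = {}"
    then have "{X \<in> space \<Omega>. \<not> survives k C 1 X} = space \<Omega>" by auto
    then have "dies 1 = 1" by (simp only: dies_def prob_space)
    then show False using q[of 1] assms(2) by simp
  qed
  have step: "1 - dies (Suc m) \<le> (1 - dies m) - f ^ 3 / 3" for m
  proof -
    define q' where "q' = 1 - dies m"
    have q': "0 < q'" "q' \<le> 1" "f \<le> q'" using q[of m] assms(2) by (auto simp: q'_def dies_def)
    have "1 / (1 + q' + q'\<^sup>2) \<le> 1 / exp q'"
      using q' exp_bound[of q'] by (intro divide_left_mono mult_pos_pos add_pos_pos) auto
    also have "\<dots> = exp (- q')" by (simp only: exp_minus inverse_eq_divide)
    also have "\<dots> \<le> exp (- (\<Sum>c\<in>C. lam c) * q')"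
      using assms(1) q' mult_right_mono[of "\<Sum>c\<in>C. lam c" 1 q'] by simp
    also have "\<dots> \<le> dies (Suc m)" unfolding q'_def by (rule dies_Suc[OF C_ne])
    finally have "1 / (1 + q' + q'\<^sup>2) \<le> dies (Suc m)" .
    moreover have "1 - q' + q' ^ 3 / 3 \<le> 1 / (1 + q' + q'\<^sup>2)"
    proof -
      have pos: "0 < 1 + q' + q'\<^sup>2" using q' by (intro add_pos_pos) auto
      have "1 + q' + q'\<^sup>2 \<le> 3" using q' power_le_one[of q' 2] by simp
      then have "q' ^ 3 / 3 \<le> q' ^ 3 / (1 + q' + q'\<^sup>2)"
        using q' pos by (intro divide_left_mono) auto
      moreover have "1 / (1 + q' + q'\<^sup>2) = 1 - q' + q' ^ 3 / (1 + q' + q'\<^sup>2)"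
        using pos by (simp add: field_simps power2_eq_square power3_eq_cube)
      ultimately show ?thesis by simp
    qed
    moreover have "f ^ 3 \<le> q' ^ 3" using q' assms(2) by (intro power_mono) auto
    ultimately show ?thesis by (simp add: q'_def)
  qed
  have "1 - dies m \<le> 1 - real m * (f ^ 3 / 3)" for m
  proof (induction m)
    case 0 then show ?case by (simp add: dies_def)
  next
    case (Suc m)
    then show ?case using step[of m] by (simp add: algebra_simps)
  qed
  moreover have "0 < f ^ 3 / 3" using assms(2) by simp
  then obtain m where "1 < real m * (f ^ 3 / 3)" using reals_Archimedean3 by blast
  ultimately show False using q[of m] assms(2) by (smt (verit))
qed

end

lemma supercritical_if_infinite_friends:
  fixes lam :: "nat \<Rightarrow> real"
  assumes pos: "\<And>i. i \<in> {1..k} \<Longrightarrow> lam i > 0" and f: "f_infinity k lam > 0" and i: "i \<in> {1..k}"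
  shows "(\<Sum>c\<in>{1..k} - {i}. lam c) > 1"
proof (rule ccontr)
  assume "\<not> ?thesis"
  then have le: "(\<Sum>c\<in>{1..k} - {i}. lam c) \<le> 1" by simp
  interpret colored_branching k lam "{1..k} - {i}"
    using pos by unfold_locales auto
  obtain m where m: "1 - dies m < f_infinity k lam" using extinction[OF le f] by blast
  have "f_infinity k lam \<le> prob {X \<in> space \<Omega>. survives k ({1..k} - {i}) m X}"
    unfolding f_infinity_def offspring_space_eq
    using survives_if_infinite_friends[OF _ i]
    by (intro finite_measure_mono survives_measurable) auto
  also have "\<dots> = 1 - dies m"
  proof -
    have "{X \<in> space \<Omega>. survives k ({1..k} - {i}) m X} =
       space \<Omega> - {X \<in> space \<Omega>. \<not> survives k ({1..k} - {i}) m X}" by auto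
    then show ?thesis
      unfolding dies_def using prob_compl[OF dies_measurable[of m]] by (simp only:)
  qed
  finally show False using m by simp
qed

section \<open>The unique largest color-avoiding connected component\<close>

definition colored_graph :: "'v set \<Rightarrow> (nat \<times> 'v set) set \<Rightarrow> 'v ecgraph" where
  "colored_graph V S = (V, \<lambda>i. {e \<in> nsets V 2. (i, e) \<in> S})"

definition edge_prob :: "(nat \<Rightarrow> real) \<Rightarrow> nat \<Rightarrow> nat \<times> 'v set \<Rightarrow> real" where
  "edge_prob lam n = (\<lambda>(c, e). 1 - exp (- lam c / real n))"

abbreviation other_colors :: "nat \<Rightarrow> nat \<Rightarrow> nat set" where
  "other_colors k i \<equiv> {1..k} - {i}"

text \<open>
  The vertices of \<open>jointly_large\<close> share their cluster for each deleted color, hence they lie in one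
  component. Conversely, a component with at least \<open>s\<close> vertices is contained, for each \<open>i\<close>, in a single cluster
  without color \<open>i\<close>, so its vertices belong to \<open>jointly_large\<close>.
\<close>

lemma unique_largest_component:
  assumes V: "finite V" and S: "S \<subseteq> {1..k} \<times> nsets V 2" and s: "s > 0"
    and unique: "\<And>i. i \<in> {1..k} \<Longrightarrow> \<not> two_large_clusters V s (S `` other_colors k i)"
    and large: "s \<le> card (jointly_large V {1..k} (other_colors k) s S)"
  shows "\<exists>!C. is_largest_component k (colored_graph V S) C"
proof -
  let ?G = "colored_graph V S"
  let ?cl = "\<lambda>i. cluster (S `` other_colors k i)"
  have edges: "edges_of_colors ?G I = S `` I" for I
    using S by (auto simp: edges_of_colors_def colored_graph_def)
  have vert: "vertices ?G = V" by (simp add: vertices_def colored_graph_def)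
  have cac: "color_avoiding_connected k ?G v w \<longleftrightarrow> (\<forall>i\<in>{1..k}. w \<in> ?cl i v)"
    if "v \<in> V" "w \<in> V" for v w
    using that by (simp add: color_avoiding_connected_def avoiding_connected_def connected_by_def
        edges vert cluster_def)
  define R where "R = {(v, w) \<in> V \<times> V. color_avoiding_connected k ?G v w}"
  have R: "(v, w) \<in> R \<longleftrightarrow> v \<in> V \<and> w \<in> V \<and> (\<forall>i\<in>{1..k}. w \<in> ?cl i v)" for v w
    using cac by (auto simp: R_def)
  have equiv: "equiv V R"
  proof (rule equivI)
    show "R \<subseteq> V \<times> V" by (auto simp: R_def)
    show "refl_on V R" by (auto simp: refl_on_def R)
    show "sym R" by (auto simp: sym_def R intro: cluster_sym)
    show "trans R" using cluster_trans by (fastforce simp: trans_def R)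
  qed
  have comps: "color_avoiding_components k ?G = V // R"
    by (simp add: color_avoiding_components_def vert R_def)
  define A where "A = jointly_large V {1..k} (other_colors k) s S"
  have A: "A \<noteq> {}" "s \<le> card A" using large s by (auto simp: A_def)
  then obtain a where a: "a \<in> A" by blast
  then have aV: "a \<in> V" by (simp add: A_def jointly_large_def)
  have A_sub: "A \<subseteq> R `` {a}"
  proof
    fix b assume b: "b \<in> A"
    have "b \<in> ?cl i a" if "i \<in> {1..k}" for i
    proof (rule ccontr)
      assume "b \<notin> ?cl i a"
      then have "two_large_clusters V s (S `` other_colors k i)"
        using a b that unfolding two_large_clusters_def A_def jointly_large_def by blast
      then show False using unique[OF that] by contradiction
    qed
    then show "b \<in> R `` {a}" using aV b by (simp add: R A_def jointly_large_def)
  qed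
  have finR: "finite (R `` {d})" for d
    using V by (rule finite_subset[rotated]) (auto simp: R)
  have sK: "s \<le> card (R `` {a})" using A(2) card_mono[OF finR A_sub] by linarith
  have only: "D = R `` {a}" if D: "D \<in> V // R" "s \<le> card D" for D
  proof -
    obtain d where d: "d \<in> V" "D = R `` {d}" using D(1) by (auto elim: quotientE)
    have "s \<le> card (?cl i d)" if "i \<in> {1..k}" for i
    proof -
      have "D \<subseteq> ?cl i d" using that by (auto simp: d R)
      then have "card D \<le> card (?cl i d)"
        using finite_cluster(1)[OF V nsets_Image[OF S] d(1)] by (intro card_mono) auto
      then show ?thesis using D(2) by linarith
    qed
    then have "d \<in> A" using d by (simp add: A_def jointly_large_def)
    then have "(a, d) \<in> R" using A_sub by blast
    then show ?thesis using equiv_class_eq[OF equiv] d(2) by blast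
  qed
  have K: "R `` {a} \<in> V // R" using aV by (rule quotientI)
  show ?thesis
  proof (rule ex1I[of _ "R `` {a}"])
    show "is_largest_component k ?G (R `` {a})"
      unfolding is_largest_component_def comps
    proof (intro conjI K ballI)
      fix D assume D: "D \<in> V // R"
      show "card D \<le> card (R `` {a})"
      proof (rule ccontr)
        assume "\<not> ?thesis"
        then show False using only[OF D] sK by force
      qed
    qed
    show "D = R `` {a}" if "is_largest_component k ?G D" for D
    proof (rule only)
      show "D \<in> V // R" using that by (simp add: is_largest_component_def comps)
      have "card (R `` {a}) \<le> card D" using that K by (simp add: is_largest_component_def comps)
      then show "s \<le> card D" using sK by linarith
    qed
  qed
qed

locale ecer_model =
  fixes k :: nat and lam :: "nat \<Rightarrow> real"
  assumes lam_pos: "\<And>i. i \<in> {1..k} \<Longrightarrow> lam i > 0"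
begin

abbreviation slots :: "nat \<Rightarrow> (nat \<times> nat set) set" where
  "slots n \<equiv> {1..k} \<times> nsets {1..n} 2"

abbreviation expect :: "nat \<Rightarrow> ((nat \<times> nat set) set \<Rightarrow> real) \<Rightarrow> real" where
  "expect n \<equiv> bexp (edge_prob lam n) (slots n)"

lemma finite_slots: "finite (slots n)"
  by (auto intro: finite_imp_finite_nsets)

lemma edge_prob_bounds:
  assumes "x \<in> slots n"
  shows "edge_prob lam n x \<in> {0..1}"
  using assms lam_pos by (fastforce simp: edge_prob_def)

lemma ecer_prob:
  "measure_pmf.prob (ecer n {1..n} k lam) Q = expect n (\<lambda>S. of_bool (colored_graph {1..n} S \<in> Q))"
proof -
  let ?M = "Pi_pmf (slots n) False (\<lambda>x. bernoulli_pmf (edge_prob lam n x))"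
  let ?g = "\<lambda>\<omega>. ({1..n}, \<lambda>i. {e \<in> nsets {1..n} 2. \<omega> (i, e)})"
  have "ecer n {1..n} k lam = map_pmf ?g ?M"
    by (simp add: ecer_def edge_prob_def case_prod_unfold)
  then have "measure_pmf.prob (ecer n {1..n} k lam) Q = measure_pmf.expectation ?M (indicator (?g -` Q))"
    by simp
  also have "\<dots> = expect n (\<lambda>S. indicator (?g -` Q) (\<lambda>x. x \<in> S))"
    by (intro Pi_bernoulli_expectation finite_slots edge_prob_bounds)
  also have "\<dots> = expect n (\<lambda>S. of_bool (colored_graph {1..n} S \<in> Q))"
    by (intro bexp_cong) (simp add: colored_graph_def indicator_def)
  finally show ?thesis .
qed

lemma merged_colors:
  assumes "C \<subseteq> {1..k}"
  shows "expect n (\<lambda>S. f (S `` C)) =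
    bexp (\<lambda>_. 1 - exp (- (\<Sum>c\<in>C. lam c) / real n)) (nsets {1..n} 2) f"
proof -
  have finC: "finite C" using assms finite_subset by auto
  have "(\<Prod>c\<in>C. 1 - (1 - exp (- lam c / real n))) = exp (- (\<Sum>c\<in>C. lam c) / real n)"
    using finC by (simp add: exp_sum[symmetric] sum_divide_distrib sum_negf)
  then show ?thesis
    using bexp_color_union[of "{1..k}" "nsets {1..n} 2" C "edge_prob lam n"
        "\<lambda>c. 1 - exp (- lam c / real n)" f] assms
    by (simp add: edge_prob_def finite_imp_finite_nsets)
qed

lemma expected_edges: "(\<Sum>x\<in>slots n. edge_prob lam n x) \<le> (\<Sum>c\<in>{1..k}. lam c) * real n"
proof -
  have "(\<Sum>x\<in>slots n. edge_prob lam n x) \<le> (\<Sum>(c, e)\<in>slots n. lam c / real n)"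
  proof (intro sum_mono, safe)
    fix c e
    show "edge_prob lam n (c, e) \<le> lam c / real n"
      using exp_ge_add_one_self[of "- lam c / real n"] by (simp add: edge_prob_def)
  qed
  also have "\<dots> = (\<Sum>c\<in>{1..k}. real (n choose 2) * (lam c / real n))"
    by (simp add: sum.cartesian_product[symmetric])
  also have "\<dots> \<le> (\<Sum>c\<in>{1..k}. real n ^ 2 * (lam c / real n))"
  proof (intro sum_mono mult_right_mono)
    show "real (n choose 2) \<le> real n ^ 2"
      unfolding of_nat_power[symmetric] using binomial_fact_pow[of n 2] by (intro of_nat_mono) simp
    show "0 \<le> lam c / real n" if "c \<in> {1..k}" for c using lam_pos[OF that] by simp
  qed
  also have "\<dots> = (\<Sum>c\<in>{1..k}. lam c * real n)"
    by (intro sum.cong) (auto simp: power2_eq_square)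
  also have "\<dots> = (\<Sum>c\<in>{1..k}. lam c) * real n" by (rule sum_distrib_right[symmetric])
  finally show ?thesis .
qed

lemma two_large_clusters_unlikely:
  assumes C: "C \<subseteq> {1..k}" "j \<in> C" and \<kappa>: "\<kappa> > 0"
  shows "(\<lambda>n. expect n (\<lambda>S. of_bool (two_large_clusters {1..n} (\<kappa> * real n) (S `` C)))) \<longlonglongrightarrow> 0"
proof -
  define l where "l = lam j"
  have l: "l > 0" using C lam_pos by (auto simp: l_def)
  let ?P = "\<lambda>n. expect n (\<lambda>S. of_bool (two_large_clusters {1..n} (\<kappa> * real n) (S `` C)))"
  let ?h = "\<lambda>n. 1 / (2 * \<kappa> ^ 4 * (real n * sqrt (1 - exp (- l / real n)) * exp (- l / real n)))"
  have bound: "?P n \<le> ?h n" if n: "n \<ge> 1" for n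
  proof -
    define q where "q = 1 - exp (- l / real n)"
    have q: "0 < q" "q < 1" using l n by (auto simp: q_def)
    have "2 * q * (1 - q) * (\<kappa> * real n) ^ 4 * ?P n \<le> real (card {1..n}) ^ 3 * sqrt q"
      using n C \<kappa> q lam_pos
      by (intro two_large_clusters_bound[where \<pi> = "\<lambda>c. 1 - exp (- lam c / real n)" and j = j])
        (auto simp: edge_prob_def q_def l_def less_imp_le)
    moreover have "2 * (r * r) * (1 - r * r) * (\<kappa> * x) ^ 4 * P =
        x ^ 3 * r * (2 * \<kappa> ^ 4 * (x * r * (1 - r * r)) * P)" for r x P :: real
      by algebra
    from this[of "sqrt q" "real n" "?P n"]
    have "2 * q * (1 - q) * (\<kappa> * real n) ^ 4 * ?P n =
        real n ^ 3 * sqrt q * (2 * \<kappa> ^ 4 * (real n * sqrt q * (1 - q)) * ?P n)"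
      using q by (simp only: real_sqrt_mult_self abs_of_pos)
    ultimately have "real n ^ 3 * sqrt q * (2 * \<kappa> ^ 4 * (real n * sqrt q * (1 - q)) * ?P n)
       \<le> real n ^ 3 * sqrt q * 1"
      by (simp only: card_atLeastAtMost diff_Suc_1 mult_1_right)
    then have "2 * \<kappa> ^ 4 * (real n * sqrt q * (1 - q)) * ?P n \<le> 1"
      using n q by (subst (asm) mult_le_cancel_left_pos) auto
    moreover have "0 < 2 * \<kappa> ^ 4 * (real n * sqrt q * (1 - q))"
      using n q \<kappa> by (intro mult_pos_pos) auto
    ultimately have "?P n \<le> 1 / (2 * \<kappa> ^ 4 * (real n * sqrt q * (1 - q)))"
      by (simp add: pos_le_divide_eq mult.commute)
    then show ?thesis by (simp add: q_def)
  qed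
  have "?h \<longlonglongrightarrow> 0" using l \<kappa> by real_asymp
  have "\<forall>\<^sub>F n in sequentially. ?P n \<le> ?h n"
    using bound by (auto simp: eventually_sequentially)
  have "\<forall>\<^sub>F n in sequentially. 0 \<le> ?P n"
    by (intro always_eventually allI bexp_nonneg edge_prob_bounds) auto
  show ?thesis
    by (rule tendsto_sandwich[OF _ _ tendsto_const]) fact+
qed

abbreviation joint_count :: "nat \<Rightarrow> real \<Rightarrow> (nat \<times> nat set) set \<Rightarrow> real" where
  "joint_count n s S \<equiv> real (card (jointly_large {1..n} {1..k} (other_colors k) s S))"

abbreviation cluster_size :: "nat \<Rightarrow> (nat \<times> nat set) set \<Rightarrow> nat \<Rightarrow> nat" where
  "cluster_size i S v \<equiv> card (cluster (S `` other_colors k i) v)"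

lemma jointly_large_concentrated:
  assumes "0 \<le> s" "0 < h"
  shows "expect n (\<lambda>S. of_bool (joint_count n s S \<le> expect n (joint_count n s) - h))
    \<le> (\<Sum>c\<in>{1..k}. lam c) * real n * (2 * real k * s)\<^sup>2 / h\<^sup>2"
proof -
  have "h\<^sup>2 * expect n (\<lambda>S. of_bool (joint_count n s S \<le> expect n (joint_count n s) - h))
    \<le> (\<Sum>x\<in>slots n. edge_prob lam n x * (1 - edge_prob lam n x) *
        expect n (\<lambda>S. (joint_count n s (insert x S) - joint_count n s (S - {x}))\<^sup>2))"
    using assms by (intro bexp_chebyshev finite_slots edge_prob_bounds) auto
  also have "\<dots> \<le> (\<Sum>x\<in>slots n. edge_prob lam n x * 1 * (2 * real k * s)\<^sup>2)"
  proof (intro sum_mono mult_mono)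
    fix x assume x: "x \<in> slots n"
    note p = edge_prob_bounds[OF x]
    show "1 - edge_prob lam n x \<le> 1" "0 \<le> edge_prob lam n x" "0 \<le> 1 - edge_prob lam n x"
      "0 \<le> edge_prob lam n x * 1" using p by auto
    show "expect n (\<lambda>S. (joint_count n s (insert x S) - joint_count n s (S - {x}))\<^sup>2) \<le> (2 * real k * s)\<^sup>2"
    proof (intro bexp_le_const finite_slots edge_prob_bounds)
      show "(joint_count n s (insert x S) - joint_count n s (S - {x}))\<^sup>2 \<le> (2 * real k * s)\<^sup>2" if "S \<subseteq> slots n" for S
        using jointly_large_increment[of "{1..n}" "{1..k}" s S "{1..k}" x "other_colors k"]
          that x assms by simp
    qed
    show "0 \<le> expect n (\<lambda>S. (joint_count n s (insert x S) - joint_count n s (S - {x}))\<^sup>2)"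
      by (intro bexp_nonneg edge_prob_bounds) auto
  qed auto
  also have "\<dots> = (\<Sum>x\<in>slots n. edge_prob lam n x) * (2 * real k * s)\<^sup>2"
    by (simp add: sum_distrib_right)
  also have "\<dots> \<le> (\<Sum>c\<in>{1..k}. lam c) * real n * (2 * real k * s)\<^sup>2"
    using expected_edges by (intro mult_right_mono) auto
  finally show ?thesis using assms by (simp add: pos_le_divide_eq mult.commute)
qed

text \<open>
  The event that the cluster of \<open>v\<close> has size at least \<open>s\<close> is increasing for each deleted color, so the Harris
  inequality bounds the probability of the intersection of these events by the product.
\<close>

lemma expected_jointly_large:
  fixes s \<sigma> :: real
  assumes "0 \<le> \<sigma>" "\<sigma> \<le> 1"
    and "\<And>i v. i \<in> {1..k} \<Longrightarrow> v \<in> {1..n} \<Longrightarrow> expect n (\<lambda>S. of_bool (cluster_size i S v < s)) \<le> \<sigma>"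
  shows "(1 - \<sigma>) ^ k * real n \<le> expect n (joint_count n s)"
proof -
  have "(1 - \<sigma>) ^ k * real n = (\<Sum>v\<in>{1..n}. \<Prod>i\<in>{1..k}. 1 - \<sigma>)" by simp
  also have "\<dots> \<le> (\<Sum>v\<in>{1..n}. \<Prod>i\<in>{1..k}. expect n (\<lambda>S. of_bool (s \<le> cluster_size i S v)))"
  proof (intro sum_mono prod_mono conjI)
    fix v i assume v: "v \<in> {1..n}" "i \<in> {1..k}"
    have "expect n (\<lambda>S. of_bool (s \<le> cluster_size i S v)) = expect n (\<lambda>S. 1 - of_bool (cluster_size i S v < s))"
      by (intro bexp_cong) auto
    also have "\<dots> = 1 - expect n (\<lambda>S. of_bool (cluster_size i S v < s))"
      using finite_slots[of n] by (simp add: bexp_diff)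
    finally show "1 - \<sigma> \<le> expect n (\<lambda>S. of_bool (s \<le> cluster_size i S v))" using assms(3) v by simp
  qed (use assms in simp)
  also have "\<dots> \<le> (\<Sum>v\<in>{1..n}. expect n (\<lambda>S. \<Prod>i\<in>{1..k}. of_bool (s \<le> cluster_size i S v)))"
  proof (intro sum_mono harris_prod finite_slots edge_prob_bounds)
    fix v i and S T :: "(nat \<times> nat set) set"
    assume v: "v \<in> {1..n}" "i \<in> {1..k}" and ST: "S \<subseteq> T" "T \<subseteq> slots n"
    have "cluster_size i S v \<le> cluster_size i T v"
      using v ST nsets_Image[of T] by (intro card_mono finite_cluster(1)[of "{1..n}"] cluster_mono) auto
    then show "(of_bool (s \<le> cluster_size i S v) :: real) \<le> of_bool (s \<le> cluster_size i T v)" by auto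
  qed auto
  also have "\<dots> = expect n (\<lambda>S. \<Sum>v\<in>{1..n}. \<Prod>i\<in>{1..k}. of_bool (s \<le> cluster_size i S v))"
    by (rule bexp_sum[symmetric])
  also have "\<dots> = expect n (joint_count n s)"
  proof (intro bexp_cong)
    fix S
    have "(\<Sum>v\<in>{1..n}. \<Prod>i\<in>{1..k}. of_bool (s \<le> cluster_size i S v)) =
       (\<Sum>v\<in>{1..n}. of_bool (\<forall>i\<in>{1..k}. s \<le> cluster_size i S v) :: real)"
      by (intro sum.cong refl) auto
    also have "\<dots> = joint_count n s S"
      by (simp add: jointly_large_def Int_def)
    finally show "(\<Sum>v\<in>{1..n}. \<Prod>i\<in>{1..k}. of_bool (s \<le> cluster_size i S v)) = joint_count n s S" .
  qed
  finally show ?thesis .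
qed

text \<open>
  The count at the linear threshold \<open>\<kappa> n\<close> is compared with the count at a constant threshold \<open>L\<close>. The latter has
  an expectation of at least \<open>a * n\<close> and is concentrated; the difference consists of vertices with some cluster
  of size between \<open>L\<close> and \<open>\<kappa> n\<close>, whose expected number is at most \<open>k * n * \<beta> ^ -(L - 1)\<close>. The first
  error vanishes as \<open>n\<close> grows with \<open>L\<close> fixed, the second one as \<open>L\<close> grows.
\<close>

lemma jointly_large_likely:
  assumes k: "k \<ge> 1" and super: "\<And>i. i \<in> {1..k} \<Longrightarrow> (\<Sum>c\<in>other_colors k i. lam c) > 1"
  shows "\<exists>\<kappa>>0. (\<lambda>n. expect n (\<lambda>S. of_bool (joint_count n (\<kappa> * real n) S < \<kappa> * real n))) \<longlonglongrightarrow> 0"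
proof -
  define \<mu> where "\<mu> = Min ((\<lambda>i. \<Sum>c\<in>other_colors k i. lam c) ` {1..k})"
  have \<mu>: "\<mu> > 1" using k super by (auto simp: \<mu>_def)
  have \<mu>_le: "\<mu> \<le> (\<Sum>c\<in>other_colors k i. lam c)" if "i \<in> {1..k}" for i
    using that by (auto simp: \<mu>_def)
  from supercritical_cluster[OF \<mu>, where 'v = nat] obtain \<delta> \<beta> \<sigma> where
    par: "\<delta> > 0" "\<beta> > 1" "0 < \<sigma>" "\<sigma> < 1" and ev: "\<forall>\<^sub>F n in sequentially. \<forall>p (V :: nat set) v.
    1 - exp (- \<mu> / real n) \<le> p \<longrightarrow> p \<le> 1 \<longrightarrow> finite V \<longrightarrow> card V = n \<longrightarrow> v \<in> V \<longrightarrow>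
    bexp (\<lambda>_. p) (nsets V 2) (\<lambda>E. \<beta> ^ (card (cluster E v) - 1)
      * of_bool (real (card (cluster E v)) \<le> \<delta> * real n)) \<le> \<sigma>" by blast
  have ev': "\<forall>\<^sub>F n in sequentially. \<forall>i\<in>{1..k}. \<forall>v\<in>{1..n}.
     expect n (\<lambda>S. \<beta> ^ (cluster_size i S v - 1) * of_bool (real (cluster_size i S v) \<le> \<delta> * real n)) \<le> \<sigma>"
    using ev
  proof eventually_elim
    case (elim n)
    show ?case
    proof (intro ballI)
      fix i v assume i: "i \<in> {1..k}" and v: "v \<in> {1..n}"
      let ?p = "1 - exp (- (\<Sum>c\<in>other_colors k i. lam c) / real n)"
      have "expect n (\<lambda>S. \<beta> ^ (cluster_size i S v - 1) * of_bool (real (cluster_size i S v) \<le> \<delta> * real n)) =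
        bexp (\<lambda>_. ?p) (nsets {1..n} 2) (\<lambda>E. \<beta> ^ (card (cluster E v) - 1)
          * of_bool (real (card (cluster E v)) \<le> \<delta> * real n))"
        by (rule merged_colors) auto
      also have "\<dots> \<le> \<sigma>"
        using elim v \<mu>_le[OF i] by (auto simp: divide_right_mono)
      finally show "expect n (\<lambda>S. \<beta> ^ (cluster_size i S v - 1) * of_bool (real (cluster_size i S v) \<le> \<delta> * real n)) \<le> \<sigma>" .
    qed
  qed
  define a where "a = (1 - \<sigma>) ^ k"
  have a: "a > 0" using par by (simp add: a_def)
  \<comment> \<open>At most \<open>\<delta>\<close>, so that the tail bound covers all sizes below \<open>\<kappa> n\<close>; at most \<open>a / 2\<close>, so that two errors of \<open>a * n / 4\<close> are affordable.\<close>
  define \<kappa> where "\<kappa> = min \<delta> (a / 2)"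
  have \<kappa>: "0 < \<kappa>" "\<kappa> \<le> \<delta>" "\<kappa> \<le> a / 2" using par a by (auto simp: \<kappa>_def)
  define \<Lambda> where "\<Lambda> = (\<Sum>c\<in>{1..k}. lam c)"
  let ?P = "\<lambda>n. expect n (\<lambda>S. of_bool (joint_count n (\<kappa> * real n) S < \<kappa> * real n))"
  have key: "\<forall>\<^sub>F n in sequentially. ?P n \<le>
      \<Lambda> * real n * (2 * real k * real L)\<^sup>2 / (a / 4 * real n)\<^sup>2 + 4 * real k / a * (1 / \<beta>) ^ (L - 1)" for L
  proof -
    have "\<forall>\<^sub>F n in sequentially. real L < \<kappa> * real n" using \<kappa> by real_asymp
    then show ?thesis using ev' eventually_gt_at_top[of 0]
    proof eventually_elim
      case (elim n)
      then have L: "real L < \<kappa> * real n" and n: "real n > 0"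
        and tail: "\<And>i v. i \<in> {1..k} \<Longrightarrow> v \<in> {1..n} \<Longrightarrow>
          expect n (\<lambda>S. \<beta> ^ (cluster_size i S v - 1) * of_bool (real (cluster_size i S v) \<le> \<delta> * real n)) \<le> \<sigma>" by auto
      let ?s = "\<kappa> * real n"
      have s\<delta>: "?s \<le> \<delta> * real n" using \<kappa> n by (intro mult_right_mono) auto
      let ?mid = "\<lambda>S i v. of_bool (real L \<le> cluster_size i S v \<and> cluster_size i S v < ?s) :: real"
      have small: "expect n (\<lambda>S. of_bool (cluster_size i S v < ?s)) \<le> \<sigma>" if iv: "i \<in> {1..k}" "v \<in> {1..n}" for i v
      proof -
        have "expect n (\<lambda>S. of_bool (cluster_size i S v < ?s)) \<le>
            expect n (\<lambda>S. \<beta> ^ (cluster_size i S v - 1) * of_bool (real (cluster_size i S v) \<le> \<delta> * real n))"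
        proof (intro bexp_mono edge_prob_bounds)
          fix S
          have "1 \<le> \<beta> ^ (cluster_size i S v - 1)" using par by (intro one_le_power) auto
          then show "of_bool (cluster_size i S v < ?s) \<le> \<beta> ^ (cluster_size i S v - 1) * of_bool (real (cluster_size i S v) \<le> \<delta> * real n)"
            using s\<delta> by auto
        qed
        then show ?thesis using tail[OF iv] by linarith
      qed
      have mid: "expect n (\<lambda>S. ?mid S i v) \<le> (1 / \<beta>) ^ (L - 1)" if iv: "i \<in> {1..k}" "v \<in> {1..n}" for i v
      proof -
        have "expect n (\<lambda>S. ?mid S i v) \<le>
            expect n (\<lambda>S. (1 / \<beta>) ^ (L - 1) * (\<beta> ^ (cluster_size i S v - 1) * of_bool (real (cluster_size i S v) \<le> \<delta> * real n)))"
        proof (intro bexp_mono edge_prob_bounds)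
          fix S
          show "?mid S i v \<le> (1 / \<beta>) ^ (L - 1) * (\<beta> ^ (cluster_size i S v - 1) * of_bool (real (cluster_size i S v) \<le> \<delta> * real n))"
          proof (cases "real L \<le> cluster_size i S v \<and> cluster_size i S v < ?s")
            case True
            then have "\<beta> ^ (L - 1) \<le> \<beta> ^ (cluster_size i S v - 1)" using par by (intro power_increasing) auto
            then show ?thesis using True s\<delta> par by (simp add: power_divide divide_simps)
          next
            case False
            then have "?mid S i v = 0" by simp
            also have "0 \<le> (1 / \<beta>) ^ (L - 1)
                * (\<beta> ^ (cluster_size i S v - 1) * of_bool (real (cluster_size i S v) \<le> \<delta> * real n))"
              using par by (intro mult_nonneg_nonneg) auto
            finally show ?thesis .
          qed
        qed
        also have "\<dots> = (1 / \<beta>) ^ (L - 1) * expect n (\<lambda>S. \<beta> ^ (cluster_size i S v - 1) * of_bool (real (cluster_size i S v) \<le> \<delta> * real n))"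
          by (rule bexp_cmult)
        also have "\<dots> \<le> (1 / \<beta>) ^ (L - 1) * 1"
          using tail[OF iv] par by (intro mult_left_mono) auto
        finally show ?thesis by simp
      qed
      have EY: "a * real n \<le> expect n (joint_count n (real L))"
        unfolding a_def
      proof (rule expected_jointly_large)
        show "expect n (\<lambda>S. of_bool (real (cluster_size i S v) < real L)) \<le> \<sigma>" if iv: "i \<in> {1..k}" "v \<in> {1..n}" for i v
        proof -
          have "expect n (\<lambda>S. of_bool (real (cluster_size i S v) < real L)) \<le> expect n (\<lambda>S. of_bool (cluster_size i S v < ?s))"
            using L by (intro bexp_mono edge_prob_bounds) auto
          then show ?thesis using small[OF iv] by linarith
        qed
      qed (use par in auto)
      let ?h = "a / 4 * real n"
      have h: "?h > 0" using a n by simp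
      let ?dev = "\<lambda>S. of_bool (joint_count n (real L) S \<le> expect n (joint_count n (real L)) - ?h) :: real"
      have loss: "joint_count n (real L) S - joint_count n ?s S \<le> (\<Sum>v\<in>{1..n}. \<Sum>i\<in>{1..k}. ?mid S i v)" for S
      proof -
        let ?J = "\<lambda>s. jointly_large {1..n} {1..k} (other_colors k) s S"
        have finJ: "finite (?J s)" for s by (simp add: jointly_large_def)
        have "card (?J (real L)) - card (?J ?s) \<le> card (?J (real L) - ?J ?s)"
          by (intro diff_card_le_card_Diff finJ)
        then have "joint_count n (real L) S - joint_count n ?s S \<le> (\<Sum>v\<in>?J (real L) - ?J ?s. 1)" by simp
        also have "\<dots> \<le> (\<Sum>v\<in>?J (real L) - ?J ?s. \<Sum>i\<in>{1..k}. ?mid S i v)"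
        proof (intro sum_mono)
          fix v assume "v \<in> ?J (real L) - ?J ?s"
          then obtain i where i: "i \<in> {1..k}" "?mid S i v = 1"
            by (auto simp: jointly_large_def not_le)
          have "?mid S i v \<le> (\<Sum>i\<in>{1..k}. ?mid S i v)"
            using i(1) by (intro member_le_sum) auto
          then show "1 \<le> (\<Sum>i\<in>{1..k}. ?mid S i v)" using i(2) by linarith
        qed
        also have "\<dots> \<le> (\<Sum>v\<in>{1..n}. \<Sum>i\<in>{1..k}. ?mid S i v)"
          by (intro sum_mono2) (auto simp: jointly_large_def sum_nonneg)
        finally show ?thesis .
      qed
      have "?P n \<le> expect n (\<lambda>S. ?dev S + 1 / ?h * (\<Sum>v\<in>{1..n}. \<Sum>i\<in>{1..k}. ?mid S i v))"
      proof (intro bexp_mono edge_prob_bounds)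
        fix S
        let ?M = "\<Sum>v\<in>{1..n}. \<Sum>i\<in>{1..k}. ?mid S i v"
        have M0: "0 \<le> 1 / ?h * ?M" using h by (intro mult_nonneg_nonneg sum_nonneg) auto
        \<comment> \<open>If the count at \<open>L\<close> does not deviate, a shortfall at \<open>?s\<close> means that at least \<open>?h\<close> vertices were lost.\<close>
        show "of_bool (joint_count n ?s S < ?s) \<le> ?dev S + 1 / ?h * ?M"
        proof (cases "joint_count n ?s S < ?s \<and> \<not> joint_count n (real L) S \<le> expect n (joint_count n (real L)) - ?h")
          case True
          have "?s \<le> a / 2 * real n" using \<kappa> n by (intro mult_right_mono) auto
          then have "?h \<le> ?M" using True EY loss[of S] by (simp add: field_simps)
          then have "1 \<le> 1 / ?h * ?M" using h by (simp add: field_simps)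
          then show ?thesis using True by simp
        next
          case False
          then show ?thesis using M0 by auto
        qed
      qed
      also have "\<dots> = expect n ?dev + 1 / ?h * (\<Sum>v\<in>{1..n}. \<Sum>i\<in>{1..k}. expect n (\<lambda>S. ?mid S i v))"
        by (simp only: bexp_add bexp_cmult bexp_sum)
      also have "\<dots> \<le> \<Lambda> * real n * (2 * real k * real L)\<^sup>2 / ?h\<^sup>2 +
          1 / ?h * (\<Sum>v\<in>{1..n}. \<Sum>i\<in>{1..k}. (1 / \<beta>) ^ (L - 1))"
        using h mid unfolding \<Lambda>_def
        by (intro add_mono jointly_large_concentrated mult_left_mono sum_mono) auto
      also have "1 / ?h * (\<Sum>v\<in>{1..n}. \<Sum>i\<in>{1..k}. (1 / \<beta>) ^ (L - 1)) = 4 * real k / a * (1 / \<beta>) ^ (L - 1)"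
        using n a by (simp add: field_simps)
      finally show ?case .
    qed
  qed
  have "?P \<longlonglongrightarrow> 0"
  proof (rule order_tendstoI)
    fix e :: real assume "e < 0"
    have "0 \<le> ?P n" for n by (intro bexp_nonneg edge_prob_bounds) auto
    with \<open>e < 0\<close> have "e < ?P n" for n by (rule less_le_trans)
    then show "\<forall>\<^sub>F n in sequentially. e < ?P n" by (intro always_eventually allI)
  next
    fix e :: real assume e: "0 < e"
    have "(\<lambda>L. 4 * real k / a * (1 / \<beta>) ^ L) \<longlonglongrightarrow> 4 * real k / a * 0"
      using par by (intro tendsto_mult tendsto_const LIMSEQ_realpow_zero) auto
    then have "\<forall>\<^sub>F L in sequentially. 4 * real k / a * (1 / \<beta>) ^ L < e / 2"
      using e by (intro order_tendstoD) auto
    then obtain L where "4 * real k / a * (1 / \<beta>) ^ L < e / 2"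
      by (auto simp: eventually_sequentially)
    then have L: "4 * real k / a * (1 / \<beta>) ^ (Suc L - 1) < e / 2" by simp
    have "(\<lambda>n. \<Lambda> * real n * (2 * real k * real (Suc L))\<^sup>2 / (a / 4 * real n)\<^sup>2) \<longlonglongrightarrow> 0"
      using a by real_asymp
    then have "\<forall>\<^sub>F n in sequentially. \<Lambda> * real n * (2 * real k * real (Suc L))\<^sup>2 / (a / 4 * real n)\<^sup>2 < e / 2"
      using e by (intro order_tendstoD) auto
    then show "\<forall>\<^sub>F n in sequentially. ?P n < e"
      using key[of "Suc L"] by eventually_elim (use L in linarith)
  qed
  then show ?thesis using \<kappa>(1) by blast
qed

end

theorem corollary2p16:
  fixes k :: nat and lam :: "nat \<Rightarrow> real"
  assumes "k \<ge> 2"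
    and "\<And>i. i \<in> {1..k} \<Longrightarrow> lam i > 0"
    and "\<And>I. I \<subseteq> {1..k} \<Longrightarrow> card I \<le> k - 2 \<Longrightarrow> (\<Sum>i\<in>I. lam i) < 1"
    and "f_infinity k lam > 0"
  shows "(\<lambda>n. measure_pmf.prob (ecer n {1..n} k lam)
            {G. \<exists>!C. is_largest_component k G C}) \<longlonglongrightarrow> 1"
proof -
  interpret ecer_model k lam
    using assms(2) by unfold_locales
  have super: "(\<Sum>c\<in>other_colors k i. lam c) > 1" if "i \<in> {1..k}" for i
    using supercritical_if_infinite_friends[OF assms(2,4) that] by simp
  have "k \<ge> 1" using assms(1) by simp
  from jointly_large_likely[OF this super] obtain \<kappa> where
    \<kappa>: "\<kappa> > 0" "(\<lambda>n. expect n (\<lambda>S. of_bool (joint_count n (\<kappa> * real n) S < \<kappa> * real n))) \<longlonglongrightarrow> 0"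
    by blast
  let ?Q = "{G. \<exists>!C. is_largest_component k G C}"
  let ?P = "\<lambda>n. measure_pmf.prob (ecer n {1..n} k lam) ?Q"
  let ?two = "\<lambda>i n. expect n (\<lambda>S. of_bool (two_large_clusters {1..n} (\<kappa> * real n) (S `` other_colors k i)))"
  let ?few = "\<lambda>n. expect n (\<lambda>S. of_bool (joint_count n (\<kappa> * real n) S < \<kappa> * real n))"
  have two: "?two i \<longlonglongrightarrow> 0" if i: "i \<in> {1..k}" for i
  proof -
    have "other_colors k i \<noteq> {}"
    proof
      assume "other_colors k i = {}"
      then show False using super[OF i] by (simp only: sum.empty)
    qed
    then obtain j where "j \<in> other_colors k i" by blast
    then show ?thesis using \<kappa>(1) by (intro two_large_clusters_unlikely) auto
  qed
  have lower: "1 - (\<Sum>i\<in>{1..k}. ?two i n) - ?few n \<le> ?P n" if n: "n \<ge> 1" for n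
  proof -
    have "1 - (\<Sum>i\<in>{1..k}. ?two i n) - ?few n =
       expect n (\<lambda>S. 1 - (\<Sum>i\<in>{1..k}. of_bool (two_large_clusters {1..n} (\<kappa> * real n) (S `` other_colors k i)))
         - of_bool (joint_count n (\<kappa> * real n) S < \<kappa> * real n))"
      by (simp only: bexp_diff bexp_sum bexp_const[OF finite_slots])
    also have "\<dots> \<le> expect n (\<lambda>S. of_bool (colored_graph {1..n} S \<in> ?Q))"
    proof (intro bexp_mono edge_prob_bounds)
      fix S assume S: "S \<subseteq> slots n"
      let ?b = "\<lambda>i. two_large_clusters {1..n} (\<kappa> * real n) (S `` other_colors k i)"
      let ?c = "joint_count n (\<kappa> * real n) S < \<kappa> * real n"
      have sum0: "0 \<le> (\<Sum>i\<in>{1..k}. of_bool (?b i) :: real)" by (intro sum_nonneg) auto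
      show "1 - (\<Sum>i\<in>{1..k}. of_bool (?b i)) - of_bool ?c \<le> (of_bool (colored_graph {1..n} S \<in> ?Q) :: real)"
      proof (cases "(\<exists>i\<in>{1..k}. ?b i) \<or> ?c")
        case True
        have "1 \<le> (\<Sum>i\<in>{1..k}. of_bool (?b i) :: real)" if i: "i \<in> {1..k}" "?b i" for i
          using member_le_sum[of i "{1..k}" "\<lambda>i. of_bool (?b i) :: real"] i by simp
        then have "1 - (\<Sum>i\<in>{1..k}. of_bool (?b i)) - of_bool ?c \<le> (0 :: real)"
          using True sum0 by (auto simp: of_bool_def)
        then show ?thesis by (rule order_trans) simp
      next
        case False
        have "\<exists>!C. is_largest_component k (colored_graph {1..n} S) C"
          using False S n \<kappa>(1) by (intro unique_largest_component[where s = "\<kappa> * real n"]) auto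
        then show ?thesis using sum0 by simp
      qed
    qed
    also have "\<dots> = ?P n" by (rule ecer_prob[symmetric])
    finally show ?thesis .
  qed
  have "(\<lambda>n. 1 - (\<Sum>i\<in>{1..k}. ?two i n) - ?few n) \<longlonglongrightarrow> 1 - (\<Sum>i\<in>{1..k}. 0) - 0"
    using two \<kappa>(2) by (intro tendsto_intros) auto
  then have "(\<lambda>n. 1 - (\<Sum>i\<in>{1..k}. ?two i n) - ?few n) \<longlonglongrightarrow> 1" by simp
  then show ?thesis
  proof (rule tendsto_sandwich[rotated 2, OF _ tendsto_const])
    show "\<forall>\<^sub>F n in sequentially. 1 - (\<Sum>i\<in>{1..k}. ?two i n) - ?few n \<le> ?P n"
      using lower by (auto simp: eventually_sequentially)
    show "\<forall>\<^sub>F n in sequentially. ?P n \<le> 1" by simp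
  qed
qed

end
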